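(* Let $G$ be a simple graph on $n$ vertices. (i) If $G$ or its complement is the complete graph, then $\mathrm{Rep}(G) = n-1$. (ii) If $G$ or its complement is the disjoint union of at least $2$ complete graphs, $r$ of which have the largest number of vertices among the components, then $\mathrm{Rep}(G) = n-\max\{r,2\}$. (iii) Otherwise, let $\tau_1<\tau_2<\dots<\tau_s$ be the distinct eigenvalues of the adjacency matrix $A=A(G)$, with multiplicities $m_i$ and main angles $\beta_i$. Define $m_1' = m_1+1$ if $\beta_1 = 0$ and $m_1' = m_1$ otherwise. Define $m_2' = m_2+2$ if $\tau_2<-1$, $m_1 = 1$, $\beta_2 = 0$ and $\frac{\beta_1^2}{\tau_2-\tau_1} = \sum_{i\geq 3}\frac{\beta_i^2}{\tau_i-\tau_2}$; define $m_2' = m_2+1$ if $\tau_2<-1$, $m_1 = 1$, $\beta_2 = 0$ and $\frac{\beta_1^2}{\tau_2-\tau_1} > \sum_{i\geq 3}\frac{\beta_i^2}{\tau_i-\tau_2}$; and $m_2' = 0$ otherwise. Define $\overline{m_1}'$ and $\overline{m_2}'$ in the same way using the adjacency matrix of the complement $\overline{G}$. Then \[ \mathrm{Rep}(G) = n-\max\{m_1',m_2',\overline{m_1}',\overline{m_2}',2\}. \]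
   Context: A simple graph $G$ is representable in $\mathbb{R}^m$ if there is a map from the vertex set of $G$ into $\mathbb{R}^m$ and distinct positive constants $\alpha\neq\beta$ such that for all distinct vertices $u,v$, the Euclidean distance between the images of $u$ and $v$ is $\alpha$ if $u\sim v$ and $\beta$ otherwise. $\mathrm{Rep}(G)$ is the smallest $m$ such that $G$ is representable in $\mathbb{R}^m$. For an eigenvalue $\tau_i$ of $A$ with eigenspace $E_i$ and orthogonal projection $P_i$ onto $E_i$, the main angle is $\beta_i = \frac{1}{\sqrt{n}}\|P_i\mathbf{1}\|$, $\mathbf{1}$ the all-ones vector.
   Formalization: Part (ii) is stated only when neither G nor its complement is complete: for the edgeless graph on n ≥ 2 vertices (n copies of K_1), and for its complement, (ii) read literally would give 0, contradicting the correct value n-1 from (i). *)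

theory Defs
  imports "HOL-Analysis.Analysis" "HOL-Library.Disjoint_Sets"
begin

text \<open>A simple graph is a symmetric irreflexive relation on a finite vertex type;
  the order of the graph is the cardinality of that type.\<close>

definition simple_graph :: "('v::finite \<Rightarrow> 'v \<Rightarrow> bool) \<Rightarrow> bool" where
  "simple_graph E \<longleftrightarrow> symp E \<and> irreflp E"

definition complement :: "('v::finite \<Rightarrow> 'v \<Rightarrow> bool) \<Rightarrow> 'v \<Rightarrow> 'v \<Rightarrow> bool" where
  "complement E u v \<longleftrightarrow> u \<noteq> v \<and> \<not> E u v"

definition complete_graph :: "('v::finite \<Rightarrow> 'v \<Rightarrow> bool) \<Rightarrow> bool" where
  "complete_graph E \<longleftrightarrow> (\<forall>u v. E u v \<longleftrightarrow> u \<noteq> v)"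

text \<open>The graph is the disjoint union of the complete graphs on the blocks of \<open>P\<close>
  (by \<^const>\<open>partition_on\<close>, the blocks are nonempty).\<close>

definition disjoint_union_of_completes :: "('v::finite \<Rightarrow> 'v \<Rightarrow> bool) \<Rightarrow> 'v set set \<Rightarrow> bool" where
  "disjoint_union_of_completes E P \<longleftrightarrow>
     partition_on UNIV P \<and> (\<forall>u v. E u v \<longleftrightarrow> u \<noteq> v \<and> (\<exists>B\<in>P. u \<in> B \<and> v \<in> B))"

definition num_largest_blocks :: "'v set set \<Rightarrow> nat" where
  "num_largest_blocks P = card {B \<in> P. card B = Max (card ` P)}"


subsection \<open>Euclidean representations\<close>

text \<open>Since the dimension varies, a point of m-dimensional space is given by the
  coordinates with index below \<open>m\<close> of a function \<^typ>\<open>nat \<Rightarrow> real\<close>;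
  \<^const>\<open>L2_set\<close> is the Euclidean norm on these coordinates.\<close>

definition representable :: "('v::finite \<Rightarrow> 'v \<Rightarrow> bool) \<Rightarrow> nat \<Rightarrow> bool" where
  "representable E m \<longleftrightarrow>
     (\<exists>(f :: 'v \<Rightarrow> nat \<Rightarrow> real) \<alpha> \<beta>. 0 < \<alpha> \<and> 0 < \<beta> \<and> \<alpha> \<noteq> \<beta> \<and>
        (\<forall>u v. u \<noteq> v \<longrightarrow>
           L2_set (\<lambda>i. f u i - f v i) {..<m} = (if E u v then \<alpha> else \<beta>)))"

definition Rep :: "('v::finite \<Rightarrow> 'v \<Rightarrow> bool) \<Rightarrow> nat" where
  "Rep E = (LEAST m. representable E m)"


subsection \<open>Eigenvalues, multiplicities and main angles\<close>

definition adjacency :: "('v::finite \<Rightarrow> 'v \<Rightarrow> bool) \<Rightarrow> real ^ 'v ^ 'v" where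
  "adjacency E = (\<chi> u v. if E u v then 1 else 0)"

definition eigenspace :: "real ^ 'v ^ 'v \<Rightarrow> real \<Rightarrow> (real ^ 'v::finite) set" where
  "eigenspace A \<tau> = {x. A *v x = \<tau> *\<^sub>R x}"

definition eigenvalues :: "real ^ 'v ^ 'v::finite \<Rightarrow> real set" where
  "eigenvalues A = {\<tau>. \<exists>x. x \<noteq> 0 \<and> A *v x = \<tau> *\<^sub>R x}"

definition orth_proj :: "'a::euclidean_space set \<Rightarrow> 'a \<Rightarrow> 'a" where
  "orth_proj S x = (THE p. p \<in> S \<and> (\<forall>z\<in>S. orthogonal (x - p) z))"

definition main_angle_of :: "real ^ 'v ^ 'v::finite \<Rightarrow> real \<Rightarrow> real" where
  "main_angle_of A \<tau> =
     1 / sqrt (real CARD('v)) * norm (orth_proj (eigenspace A \<tau>) (\<chi> v. 1))"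

text \<open>The distinct eigenvalues are numbered increasingly from 1, each counted once.
  The functions \<open>eig\<close>, \<open>mult\<close> and \<open>main_angle\<close> are meant for symmetric matrices and for
  indices between 1 and \<open>num_eigs\<close>.  Algebraic and geometric multiplicities then agree.\<close>

definition num_eigs :: "real ^ 'v ^ 'v::finite \<Rightarrow> nat" where
  "num_eigs A = card (eigenvalues A)"

definition eig :: "real ^ 'v ^ 'v::finite \<Rightarrow> nat \<Rightarrow> real" where
  "eig A i = sorted_list_of_set (eigenvalues A) ! (i - 1)"

definition mult :: "real ^ 'v ^ 'v::finite \<Rightarrow> nat \<Rightarrow> nat" where
  "mult A i = dim (eigenspace A (eig A i))"

definition main_angle :: "real ^ 'v ^ 'v::finite \<Rightarrow> nat \<Rightarrow> real" where
  "main_angle A i = main_angle_of A (eig A i)"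

definition m1' :: "real ^ 'v ^ 'v::finite \<Rightarrow> nat" where
  "m1' A = (if main_angle A 1 = 0 then mult A 1 + 1 else mult A 1)"

definition m2' :: "real ^ 'v ^ 'v::finite \<Rightarrow> nat" where
  "m2' A =
     (let \<tau> = eig A; m = mult A; \<beta> = main_angle A;
          l = (\<beta> 1)\<^sup>2 / (\<tau> 2 - \<tau> 1);
          r = (\<Sum>i = 3..num_eigs A. (\<beta> i)\<^sup>2 / (\<tau> i - \<tau> 2))
      in if \<tau> 2 < -1 \<and> m 1 = 1 \<and> \<beta> 2 = 0 \<and> l = r then m 2 + 2
         else if \<tau> 2 < -1 \<and> m 1 = 1 \<and> \<beta> 2 = 0 \<and> l > r then m 2 + 1
         else 0)"


subsection \<open>Well-definedness\<close>

lemma orth_proj_unique: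
  fixes S :: "'a::euclidean_space set"
  assumes "subspace S"
  shows "\<exists>!p. p \<in> S \<and> (\<forall>z\<in>S. orthogonal (x - p) z)"
proof -
  have sp: "span S = S" using assms by (simp add: span_eq_iff)
  obtain y z where yz: "y \<in> span S" "\<And>w. w \<in> span S \<Longrightarrow> orthogonal z w" "x = y + z"
    using orthogonal_subspace_decomp_exists[of S x] by metis
  show ?thesis
  proof (rule ex1I[of _ y])
    show "y \<in> S \<and> (\<forall>z\<in>S. orthogonal (x - y) z)" using yz sp by auto
  next
    fix p assume p: "p \<in> S \<and> (\<forall>z\<in>S. orthogonal (x - p) z)"
    have "p - y \<in> S" using p yz(1) sp assms by (simp add: subspace_diff)
    then have "orthogonal (x - p) (p - y)" "orthogonal (x - y) (p - y)"
      using p yz sp by auto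
    then have "(p - y) \<bullet> (p - y) = 0"
      by (simp add: orthogonal_def inner_diff_left)
    then show "p = y" by simp
  qed
qed

lemma subspace_eigenspace: "subspace (eigenspace A \<tau>)"
  by (auto simp: subspace_def eigenspace_def matrix_vector_right_distrib
      matrix_vector_mult_scaleR scaleR_add_right)

lemma finite_eigenvalues:
  fixes A :: "real ^ 'v ^ 'v::finite"
  assumes "transpose A = A"
  shows "finite (eigenvalues A)"
proof -
  obtain f where f: "\<And>\<tau>. \<tau> \<in> eigenvalues A \<Longrightarrow> f \<tau> \<noteq> 0 \<and> A *v f \<tau> = \<tau> *\<^sub>R f \<tau>"
  proof -
    have "\<forall>\<tau>\<in>eigenvalues A. \<exists>x. x \<noteq> 0 \<and> A *v x = \<tau> *\<^sub>R x"
      by (simp add: eigenvalues_def)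
    then show ?thesis using that by (metis (no_types, lifting) bchoice)
  qed
  have sym: "(A *v x) \<bullet> y = x \<bullet> (A *v y)" for x y :: "real ^ 'v"
    by (metis assms dot_lmul_matrix transpose_matrix_vector)
  have "f \<sigma> \<bullet> f \<tau> = 0" if "\<sigma> \<in> eigenvalues A" "\<tau> \<in> eigenvalues A" "\<sigma> \<noteq> \<tau>" for \<sigma> \<tau>
    using sym[of "f \<sigma>" "f \<tau>"] f that by simp
  then have orth: "pairwise orthogonal (f ` eigenvalues A)"
    unfolding pairwise_def orthogonal_def by blast
  have "0 \<notin> f ` eigenvalues A" using f by force
  then have "finite (f ` eigenvalues A)"
    using orth pairwise_orthogonal_independent independent_bound by blast
  moreover have "inj_on f (eigenvalues A)"
    by (rule inj_onI) (metis f scaleR_right_imp_eq)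
  ultimately show ?thesis by (simp add: finite_image_iff)
qed

lemma symmetric_adjacency:
  assumes "simple_graph E"
  shows "transpose (adjacency E) = adjacency E"
  using assms by (auto simp: simple_graph_def transpose_def adjacency_def vec_eq_iff dest: sympD)

end

theory Submission
  imports Defs
begin

text \<open>Let \<open>B\<close> be the adjacency matrix of the graph whose edges are the shorter of the two distances
  (the graph or its complement).  On the hyperplane orthogonal to the all-ones vector, the Gram form of
  a two-distance representation is, up to scaling, the form of \<open>B + c I\<close> for some \<open>c > 1\<close>, and every
  such form that is positive semidefinite there comes from a representation whose dimension is its
  rank.  The rank drops only if \<open>- c\<close> is the least eigenvalue of the compression of \<open>B\<close> to the hyperplane,
  so \<open>Rep\<close> is \<open>n - 1\<close> minus the larger of the two multiplicities of these least eigenvalues, where an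
  eigenvalue \<open>\<ge> -1\<close> counts as multiplicity zero.  An induced path on three vertices forces it below
  \<open>-1\<close>; so it is \<open>\<ge> -1\<close> exactly for disjoint unions of complete graphs.

  The least eigenvalue of the compression lies between \<open>\<tau>\<^sub>1\<close> and \<open>\<tau>\<^sub>2\<close> (and is \<open>\<tau>\<^sub>1\<close> if \<open>m\<^sub>1 \<ge> 2\<close> or
  \<open>\<beta>\<^sub>1 = 0\<close>).  When \<open>m\<^sub>1 = 1\<close>, \<open>\<beta>\<^sub>1 \<noteq> 0\<close> and \<open>\<beta>\<^sub>2 = 0\<close>, the equation \<open>(B - \<tau>\<^sub>2 I) w = 1\<close> has a solution
  \<open>w\<close>, and the sign of \<open>w \<bullet> 1\<close>, which is \<open>n\<close> times the difference of the two sides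
  compared in the definition of \<open>m\<^sub>2'\<close>, decides whether \<open>\<tau>\<^sub>2\<close> is attained.\<close>

section \<open>Semidefinite forms on subspaces\<close>

definition self_adjoint :: "('a::real_inner \<Rightarrow> 'a) \<Rightarrow> bool" where
  "self_adjoint T \<longleftrightarrow> linear T \<and> (\<forall>x y. T x \<bullet> y = x \<bullet> T y)"

definition nonneg_on :: "'a::real_inner set \<Rightarrow> ('a \<Rightarrow> 'a) \<Rightarrow> bool" where
  "nonneg_on S T \<longleftrightarrow> (\<forall>x\<in>S. 0 \<le> x \<bullet> T x)"

text \<open>For a nonnegative form of a self-adjoint \<open>T\<close> these isotropic vectors are
  the radical of the form on the subspace \<open>S\<close> (\<open>null_on_iff\<close>), so their
  dimension is the defect of its rank.\<close>

definition null_on :: "'a::real_inner set \<Rightarrow> ('a \<Rightarrow> 'a) \<Rightarrow> 'a set" where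
  "null_on S T = {x\<in>S. x \<bullet> T x = 0}"

lemma self_adjoint_form_add:
  assumes "self_adjoint T"
  shows "(x + t *\<^sub>R y) \<bullet> T (x + t *\<^sub>R y) = x \<bullet> T x + 2 * t * (y \<bullet> T x) + t\<^sup>2 * (y \<bullet> T y)"
proof -
  have T: "linear T" "x \<bullet> T y = T x \<bullet> y"
    using assms by (auto simp: self_adjoint_def)
  show ?thesis
    by (simp add: linear_add[OF T(1)] linear_scale[OF T(1)] inner_add_left inner_add_right T(2)
        inner_commute power2_eq_square algebra_simps)
qed

text \<open>The value of the form at \<open>x + t *\<^sub>R y\<close> is a polynomial in
  \<open>t\<close> of degree at most two that is never negative; its value at the minimiser gives
  the inequality.\<close>

lemma nonneg_on_Cauchy_Schwarz:
  assumes T: "self_adjoint T" and S: "subspace S" and nn: "nonneg_on S T"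
    and x: "x \<in> S" and y: "y \<in> S"
  shows "(y \<bullet> T x)\<^sup>2 \<le> (x \<bullet> T x) * (y \<bullet> T y)"
proof -
  have nn': "0 \<le> x \<bullet> T x + 2 * t * (y \<bullet> T x) + t\<^sup>2 * (y \<bullet> T y)" for t
    unfolding self_adjoint_form_add[OF T, symmetric]
    using nn S x y by (simp add: nonneg_on_def subspace_add subspace_scale)
  have y0: "0 \<le> y \<bullet> T y" using nn y by (simp add: nonneg_on_def)
  show ?thesis
  proof (cases "y \<bullet> T y = 0")
    case True
    have "y \<bullet> T x = 0"
    proof (rule ccontr)
      assume "y \<bullet> T x \<noteq> 0"
      then show False
        \<comment> \<open>For \<open>y \<bullet> T y = 0\<close> the polynomial is affine in
          \<open>t\<close>, and this \<open>t\<close> gives it the value -1.\<close>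
        using nn'[of "- (x \<bullet> T x + 1) / (2 * (y \<bullet> T x))"] True by (simp add: field_simps)
    qed
    then show ?thesis using True by simp
  next
    case False
    have "0 \<le> x \<bullet> T x - (y \<bullet> T x)\<^sup>2 / (y \<bullet> T y)"
      using nn'[of "- (y \<bullet> T x) / (y \<bullet> T y)"] False
      by (simp add: power2_eq_square field_simps)
    then show ?thesis using False y0
      by (simp add: field_simps)
  qed
qed

text \<open>By Cauchy-Schwarz an isotropic vector pairs to zero with all of \<open>S\<close>. This
  linear condition is what makes the null set a subspace.\<close>

lemma null_on_iff:
  assumes "self_adjoint T" "subspace S" "nonneg_on S T"
  shows "x \<in> null_on S T \<longleftrightarrow> x \<in> S \<and> (\<forall>y\<in>S. y \<bullet> T x = 0)"
  using nonneg_on_Cauchy_Schwarz[OF assms, of x] by (force simp: null_on_def)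

lemma subspace_null_on:
  assumes T: "self_adjoint T" and S: "subspace S" and nn: "nonneg_on S T"
  shows "subspace (null_on S T)"
proof -
  have lin: "linear T" using T by (simp add: self_adjoint_def)
  have "null_on S T = {x \<in> S. \<forall>y\<in>S. y \<bullet> T x = 0}"
    using null_on_iff[OF assms] by blast
  then show ?thesis using S
    by (auto simp: subspace_def linear_0[OF lin] linear_add[OF lin] linear_scale[OF lin] inner_add_right)
qed

lemma dim_strict_mono:
  fixes N :: "'a::euclidean_space set"
  assumes "subspace N" "subspace M" "N \<subseteq> M" "y \<in> M" "y \<notin> N"
  shows "dim N < dim M"
  by (metis assms dim_psubset order_le_less span_eq_iff)

text \<open>Lagrange reduction: splitting off the square of \<open>T y\<close> enlarges the null space by \<open>y\<close>.\<close>

lemma nonneg_on_sum_of_squares: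
  fixes T :: "'a::euclidean_space \<Rightarrow> 'a"
  assumes "self_adjoint T" "subspace S" "nonneg_on S T" "dim S \<le> dim (null_on S T) + m"
  shows "\<exists>g :: nat \<Rightarrow> 'a. \<forall>x\<in>S. x \<bullet> T x = (\<Sum>i<m. (x \<bullet> g i)\<^sup>2)"
  using assms
proof (induction m arbitrary: T)
  case 0
  \<comment> \<open>No squares are allowed here: the null space has full dimension, so the form
    vanishes on \<open>S\<close> and equals the empty sum.\<close>
  have "null_on S T = S"
    using subspace_dim_equal[of "null_on S T" S] subspace_null_on[of T S] 0
    by (auto simp: null_on_def)
  then show ?case by (auto simp: null_on_def)
next
  case (Suc m)
  note sa = Suc.prems(1) and S = Suc.prems(2) and nn = Suc.prems(3)
  have lin: "linear T" and sym: "\<And>x y. T x \<bullet> y = x \<bullet> T y"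
    using sa by (auto simp: self_adjoint_def)
  show ?case
  proof (cases "\<exists>y\<in>S. y \<bullet> T y \<noteq> 0")
    case False
    then show ?thesis by (intro exI[of _ "\<lambda>_. 0"]) simp
  next
    case True
    then obtain y0 where y0: "y0 \<in> S" "y0 \<bullet> T y0 \<noteq> 0" by blast
    then have pos: "0 < y0 \<bullet> T y0" using nn by (force simp: nonneg_on_def)
    define y where "y = (1 / sqrt (y0 \<bullet> T y0)) *\<^sub>R y0"
    have yS: "y \<in> S" using y0 S by (simp add: y_def subspace_scale)
    have y1: "y \<bullet> T y = 1" using pos by (simp add: y_def linear_scale[OF lin])
    define T' where "T' x = T x - (x \<bullet> T y) *\<^sub>R T y" for x
    have T'form: "x \<bullet> T' x = x \<bullet> T x - (x \<bullet> T y)\<^sup>2" for x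
      by (simp add: T'_def inner_diff_right power2_eq_square)
    have "linear T'"
      unfolding T'_def
      by (intro linearI) (simp_all add: linear_add[OF lin] linear_scale[OF lin] algebra_simps)
    moreover have "T' u \<bullet> z = u \<bullet> T' z" for u z
      using sym[of u z] by (simp add: T'_def inner_diff_left inner_diff_right inner_commute[of z "T y"])
    ultimately have sa': "self_adjoint T'"
      by (simp add: self_adjoint_def)
    \<comment> \<open>As \<open>y\<close> is scaled to \<open>y \<bullet> T y = 1\<close>,
      Cauchy-Schwarz says exactly that the form stays nonnegative after the square is
      subtracted.\<close>
    have nn': "nonneg_on S T'"
      using nonneg_on_Cauchy_Schwarz[OF sa S nn yS] y1 by (simp add: nonneg_on_def T'form)
    have "null_on S T \<subseteq> null_on S T'"
      using nonneg_on_Cauchy_Schwarz[OF sa S nn yS] by (force simp: null_on_def T'form)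
    moreover have "y \<in> null_on S T'" "y \<notin> null_on S T"
      using yS y1 by (auto simp: null_on_def T'form)
    ultimately have "dim (null_on S T) < dim (null_on S T')"
      using dim_strict_mono subspace_null_on[OF sa S nn] subspace_null_on[OF sa' S nn'] by blast
    then obtain g where g: "\<forall>x\<in>S. x \<bullet> T' x = (\<Sum>i<m. (x \<bullet> g i)\<^sup>2)"
      using Suc.IH[OF sa' S nn'] Suc.prems(4) by auto
    have "x \<bullet> T x = (\<Sum>i<Suc m. (x \<bullet> (g(m := T y)) i)\<^sup>2)" if "x \<in> S" for x
      using g that T'form[of x] by simp
    then show ?thesis by blast
  qed
qed

text \<open>Dimension formula for the sum of \<open>S\<close> and a subspace of codimension at most
  one. Its main use is that a null space meeting some hyperplane only in 0 has dimension at most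
  one.\<close>

lemma dim_Int_hyperplane_ge:
  fixes S :: "'a::euclidean_space set"
  assumes "subspace S"
  shows "dim S \<le> dim (S \<inter> {x. x \<bullet> a = 0}) + 1"
proof -
  have H: "subspace {x. x \<bullet> a = 0}" by (simp add: subspace_def inner_add_left)
  have d: "dim {x. x \<bullet> a = 0} \<ge> DIM('a) - 1"
    using dim_hyperplane[of a] by (cases "a = 0") (auto simp: inner_commute)
  have "dim {x + y |x y. x \<in> S \<and> y \<in> {x. x \<bullet> a = 0}} \<le> DIM('a)"
    by (rule dim_subset_UNIV)
  then show ?thesis
    using dim_sums_Int[OF assms H] d by linarith
qed

lemma dim_Int_hyperplane:
  fixes S :: "'a::euclidean_space set"
  assumes "subspace S" "b \<in> S" "b \<bullet> a \<noteq> 0"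
  shows "dim S = dim (S \<inter> {x. x \<bullet> a = 0}) + 1"
proof -
  have "subspace (S \<inter> {x. x \<bullet> a = 0})"
    using assms(1) by (auto simp: subspace_def inner_add_left)
  then have "dim (S \<inter> {x. x \<bullet> a = 0}) < dim S"
    using assms by (intro dim_strict_mono[where y = b]) auto
  then show ?thesis using dim_Int_hyperplane_ge[OF assms(1), of a] by linarith
qed

text \<open>The form attains its minimum on the unit sphere of \<open>S\<close> by compactness;
  \<open>c\<close> is minus this minimum, and the minimiser is the null vector.\<close>

lemma exists_nonneg_shift:
  fixes T :: "'a::euclidean_space \<Rightarrow> 'a"
  assumes T: "linear T" and S: "subspace S" and ne: "S \<noteq> {0}"
  shows "\<exists>c. nonneg_on S (\<lambda>x. T x + c *\<^sub>R x) \<and> (\<exists>x\<in>null_on S (\<lambda>x. T x + c *\<^sub>R x). x \<noteq> 0)"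
proof -
  obtain z where z: "z \<in> S" "z \<noteq> 0" using ne subspace_0[OF S] by blast
  have "compact (sphere 0 1 \<inter> S)"
    using closed_subspace[OF S] by (simp add: compact_Int_closed)
  moreover have "(1 / norm z) *\<^sub>R z \<in> sphere 0 1 \<inter> S"
    using z S by (simp add: subspace_scale)
  moreover have "continuous_on (sphere 0 1 \<inter> S) (\<lambda>x. x \<bullet> T x)"
    using T by (intro continuous_intros linear_continuous_on) (simp add: linear_conv_bounded_linear)
  ultimately obtain x where x: "x \<in> sphere 0 1 \<inter> S"
    and min: "\<And>y. y \<in> sphere 0 1 \<inter> S \<Longrightarrow> x \<bullet> T x \<le> y \<bullet> T y"
    using continuous_attains_inf[of "sphere 0 1 \<inter> S" "\<lambda>x. x \<bullet> T x"] by blast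
  define c where "c = - (x \<bullet> T x)"
  have "0 \<le> y \<bullet> (T y + c *\<^sub>R y)" if "y \<in> S" for y
  proof (cases "y = 0")
    case False
    have "x \<bullet> T x \<le> ((1 / norm y) *\<^sub>R y) \<bullet> T ((1 / norm y) *\<^sub>R y)"
      using min[of "(1 / norm y) *\<^sub>R y"] that False S by (simp add: subspace_scale)
    also have "\<dots> = (y \<bullet> T y) / (y \<bullet> y)"
      by (simp add: linear_scale[OF T] dot_square_norm power2_eq_square)
    finally show ?thesis using False
      by (simp add: c_def inner_diff_right field_simps)
  qed simp
  moreover have "x \<in> null_on S (\<lambda>x. T x + c *\<^sub>R x)" "x \<noteq> 0"
    using x by (auto simp: null_on_def c_def inner_diff_right dot_square_norm)
  ultimately show ?thesis by (auto simp: nonneg_on_def)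
qed

section \<open>Representations and semidefinite shifts of the adjacency matrix\<close>

definition ones :: "real ^ 'v::finite" where
  "ones = (\<chi> v. 1)"

definition sum_zero :: "(real ^ 'v::finite) set" where
  "sum_zero = {x. x \<bullet> ones = 0}"

definition shift :: "real ^ 'v ^ 'v \<Rightarrow> real \<Rightarrow> real ^ 'v \<Rightarrow> real ^ 'v::finite" where
  "shift A c x = A *v x + c *\<^sub>R x"

lemma subspace_sum_zero: "subspace sum_zero"
  by (simp add: sum_zero_def subspace_def inner_add_left)

lemma inner_ones: "x \<bullet> ones = (\<Sum>v\<in>UNIV. x $ v)"
  by (simp add: ones_def inner_vec_def)

lemma ones_inner_ones: "(ones :: real ^ 'v::finite) \<bullet> ones = real CARD('v)"
  by (simp add: inner_ones) (simp add: ones_def)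

lemma ones_nonzero: "ones \<noteq> (0 :: real ^ 'v::finite)"
  using ones_inner_ones[where 'v = 'v] by auto

lemma dim_sum_zero: "dim (sum_zero :: (real ^ 'v::finite) set) = CARD('v) - 1"
proof -
  have "sum_zero = {x :: real ^ 'v. ones \<bullet> x = 0}"
    by (simp add: sum_zero_def inner_commute)
  then show ?thesis
    using dim_hyperplane[OF ones_nonzero[where 'v = 'v]] by simp
qed

lemma axis_component: "axis a (1 :: real) $ b = (if b = a then 1 else 0)"
  by (simp add: axis_def)

lemma matrix_vector_inner:
  fixes A :: "real ^ 'v ^ 'v::finite"
  assumes "transpose A = A"
  shows "(A *v x) \<bullet> y = x \<bullet> (A *v y)"
  by (metis assms dot_lmul_matrix transpose_matrix_vector)

lemma self_adjoint_shift:
  assumes "transpose A = A"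
  shows "self_adjoint (shift A c)"
proof -
  have "linear (shift A c)"
    unfolding shift_def
    by (intro linearI) (simp_all add: matrix_vector_right_distrib matrix_vector_mult_scaleR algebra_simps)
  then show ?thesis
    by (simp add: self_adjoint_def shift_def inner_add_left inner_add_right matrix_vector_inner[OF assms])
qed

lemma inner_shift: "x \<bullet> shift A c x = x \<bullet> (A *v x) + c * (x \<bullet> x)"
  by (simp add: shift_def inner_add_right)

lemma inner_matrix_vector:
  "x \<bullet> (A *v y) = (\<Sum>u\<in>UNIV. \<Sum>v\<in>UNIV. x $ u * A $ u $ v * y $ v)"
  for A :: "real ^ 'v ^ 'v::finite"
  by (simp add: inner_vec_def matrix_vector_mult_def sum_distrib_left mult.assoc)

section \<open>Passing to the complement\<close>

lemma simple_graph_complement: "simple_graph E \<Longrightarrow> simple_graph (complement E)"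
  by (auto simp: simple_graph_def complement_def symp_def irreflp_def)

lemma complement_complement: "simple_graph E \<Longrightarrow> complement (complement E) = E"
  by (auto simp: simple_graph_def complement_def fun_eq_iff irreflp_def)

lemma representable_complement:
  assumes "simple_graph E" "representable E m"
  shows "representable (complement E) m"
proof -
  obtain f \<alpha> \<beta> where *: "0 < \<alpha>" "0 < \<beta>" "\<alpha> \<noteq> \<beta>"
    "\<And>u v. u \<noteq> v \<Longrightarrow> L2_set (\<lambda>i. f u i - f v i) {..<m} = (if E u v then \<alpha> else \<beta>)"
    using assms(2) unfolding representable_def by blast
  show ?thesis
    unfolding representable_def
    by (rule exI[of _ f], rule exI[of _ \<beta>], rule exI[of _ \<alpha>]) (use * in \<open>auto simp: complement_def\<close>)
qed

text \<open>The complement has adjacency matrix J - I - A, and the all-ones matrix J annihilates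
  vectors with coordinate sum zero.\<close>

lemma sum_zero_inner_adjacency_complement:
  fixes x :: "real ^ 'v::finite"
  assumes "simple_graph E" "x \<in> sum_zero"
  shows "x \<bullet> (adjacency (complement E) *v x) = - (x \<bullet> x) - x \<bullet> (adjacency E *v x)"
proof -
  have e: "adjacency (complement E) $ u $ v = 1 - (if u = v then 1 else 0) - adjacency E $ u $ v" for u v
    using assms(1) by (auto simp: adjacency_def complement_def simple_graph_def irreflp_def)
  have s0: "(\<Sum>v\<in>UNIV. x $ v) = 0"
    using assms(2) by (simp add: sum_zero_def inner_ones)
  have "(adjacency (complement E) *v x) = - x - adjacency E *v x"
    by (simp add: vec_eq_iff matrix_vector_mult_def e left_diff_distrib sum_subtractf s0 if_distrib[of "\<lambda>a. a * _"]
        cong: if_cong)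
  then show ?thesis by (simp add: inner_diff_right)
qed

text \<open>The sum over all \<open>u\<close>, \<open>v\<close> of \<open>x $ u * x $ v\<close>
  times the squared distance is computed twice: coordinate by coordinate, and from the two distance
  values.\<close>

lemma representation_form:
  fixes f :: "'v::finite \<Rightarrow> nat \<Rightarrow> real"
  assumes E: "simple_graph E" and x: "x \<in> sum_zero"
    and f: "\<And>u v. u \<noteq> v \<Longrightarrow> L2_set (\<lambda>i. f u i - f v i) {..<m} = (if E u v then \<alpha> else \<beta>)"
    and ab: "0 < \<alpha>" "0 < \<beta>"
  shows "2 * (\<Sum>i<m. (x \<bullet> (\<chi> v. f v i))\<^sup>2) = (\<beta>\<^sup>2 - \<alpha>\<^sup>2) * (x \<bullet> (adjacency E *v x)) + \<beta>\<^sup>2 * (x \<bullet> x)"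
proof -
  have s0: "(\<Sum>v\<in>UNIV. x $ v) = 0"
    using x by (simp add: sum_zero_def inner_ones)
  define D where "D u v = (\<Sum>i<m. (f u i - f v i)\<^sup>2)" for u v
  \<comment> \<open>The matrix of squared distances is \<beta>^2 (J - I) - (\<beta>^2 - \<alpha>^2)
    A; its J part disappears in the double sum because \<open>x\<close> has coordinate sum
    zero.\<close>
  have D: "D u v = \<beta>\<^sup>2 - \<beta>\<^sup>2 * (if u = v then 1 else 0) - (\<beta>\<^sup>2 - \<alpha>\<^sup>2) * adjacency E $ u $ v" for u v
  proof (cases "u = v")
    case True
    then show ?thesis using E by (simp add: D_def adjacency_def simple_graph_def irreflp_def)
  next
    case False
    have "0 \<le> D u v" by (simp add: D_def sum_nonneg)
    then have "D u v = (L2_set (\<lambda>i. f u i - f v i) {..<m})\<^sup>2"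
      by (simp add: L2_set_def D_def)
    then show ?thesis using f[OF False] False by (simp add: adjacency_def)
  qed
  \<comment> \<open>When the square is expanded, the two pure terms carry a factor equal to the
    coordinate sum of \<open>x\<close>, so only the mixed term survives.\<close>
  have one: "(\<Sum>u\<in>UNIV. \<Sum>v\<in>UNIV. x $ u * x $ v * (g u - g v)\<^sup>2) = - 2 * (\<Sum>v\<in>UNIV. x $ v * g v)\<^sup>2"
    for g :: "'v \<Rightarrow> real"
  proof -
    have e: "x $ u * x $ v * (g u - g v)\<^sup>2 =
        (x $ u * (g u)\<^sup>2) * x $ v + x $ u * (x $ v * (g v)\<^sup>2) - 2 * ((x $ u * g u) * (x $ v * g v))" for u v
      by (simp add: power2_eq_square algebra_simps)
    show ?thesis
      unfolding e sum.distrib sum_subtractf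
      by (simp add: sum_distrib_left[symmetric] sum_distrib_right[symmetric] s0 power2_eq_square)
  qed
  have "(\<Sum>u\<in>UNIV. \<Sum>v\<in>UNIV. x $ u * x $ v * D u v)
      = (\<Sum>u\<in>UNIV. \<Sum>v\<in>UNIV. \<Sum>i<m. x $ u * x $ v * (f u i - f v i)\<^sup>2)"
    by (simp add: D_def sum_distrib_left)
  also have "\<dots> = (\<Sum>i<m. \<Sum>u\<in>UNIV. \<Sum>v\<in>UNIV. x $ u * x $ v * (f u i - f v i)\<^sup>2)"
    by (subst sum.swap, rule sum.cong[OF refl], subst sum.swap) simp
  also have "\<dots> = - 2 * (\<Sum>i<m. (x \<bullet> (\<chi> v. f v i))\<^sup>2)"
    by (simp add: one sum_distrib_left inner_vec_def)
  finally have L: "(\<Sum>u\<in>UNIV. \<Sum>v\<in>UNIV. x $ u * x $ v * D u v) = - 2 * (\<Sum>i<m. (x \<bullet> (\<chi> v. f v i))\<^sup>2)" .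
  have e: "x $ u * x $ v * D u v = \<beta>\<^sup>2 * (x $ u * x $ v) - \<beta>\<^sup>2 * (if u = v then x $ u * x $ u else 0)
      - (\<beta>\<^sup>2 - \<alpha>\<^sup>2) * (x $ u * adjacency E $ u $ v * x $ v)" for u v
    by (simp add: D algebra_simps)
  have "(\<Sum>u\<in>UNIV. \<Sum>v\<in>UNIV. x $ u * x $ v * D u v) =
      - \<beta>\<^sup>2 * (x \<bullet> x) - (\<beta>\<^sup>2 - \<alpha>\<^sup>2) * (x \<bullet> (adjacency E *v x))"
    unfolding e sum.distrib sum_subtractf inner_matrix_vector
    by (simp add: sum_distrib_left[symmetric] s0 inner_vec_def)
  then show ?thesis using L by linarith
qed

text \<open>The condition \<open>c > 1\<close> keeps both squared distances,
  \<open>2 * (c - 1)\<close> and \<open>2 * c\<close>, positive. The inequality for \<open>k\<close>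
  makes the predicate downward closed, matching that representability is preserved when the
  dimension grows.\<close>

definition attains_nullity :: "('v::finite \<Rightarrow> 'v \<Rightarrow> bool) \<Rightarrow> nat \<Rightarrow> bool" where
  "attains_nullity E k \<longleftrightarrow> (\<exists>c>1. nonneg_on sum_zero (shift (adjacency E) c) \<and>
     k \<le> dim (null_on sum_zero (shift (adjacency E) c)))"

lemma attains_nullity_of_representable:
  fixes E :: "'v::finite \<Rightarrow> 'v \<Rightarrow> bool"
  assumes E: "simple_graph E" and ab: "0 < \<alpha>" "\<alpha> < \<beta>"
    and f: "\<And>u v. u \<noteq> v \<Longrightarrow> L2_set (\<lambda>i. f u i - f v i) {..<m} = (if E u v then \<alpha> else \<beta>)"
  shows "attains_nullity E (CARD('v) - 1 - m)"
proof -
  \<comment> \<open>With this ratio the right-hand side of \<open>representation_form\<close> is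
    \<beta>^2 - \<alpha>^2 times the shifted form.\<close>
  define c where "c = \<beta>\<^sup>2 / (\<beta>\<^sup>2 - \<alpha>\<^sup>2)"
  have d: "0 < \<beta>\<^sup>2 - \<alpha>\<^sup>2" using ab by (simp add: power_strict_mono)
  have c1: "c > 1" using d ab by (simp add: c_def)
  have form: "(\<beta>\<^sup>2 - \<alpha>\<^sup>2) * (x \<bullet> shift (adjacency E) c x) = 2 * (\<Sum>i<m. (x \<bullet> (\<chi> v. f v i))\<^sup>2)"
    if "x \<in> sum_zero" for x
    using representation_form[OF E that f] ab d by (simp add: inner_shift c_def distrib_left)
  have nn: "nonneg_on sum_zero (shift (adjacency E) c)"
    unfolding nonneg_on_def
  proof
    fix x :: "real ^ 'v" assume "x \<in> sum_zero"
    then have "0 \<le> (\<beta>\<^sup>2 - \<alpha>\<^sup>2) * (x \<bullet> shift (adjacency E) c x)"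
      by (simp add: form sum_nonneg)
    then show "0 \<le> x \<bullet> shift (adjacency E) c x" using d by (simp add: zero_le_mult_iff)
  qed
  \<comment> \<open>Vectors orthogonal to \<open>ones\<close> and to the \<open>m\<close> coordinate
    functions lie in \<open>sum_zero\<close> and are null; at most \<open>m + 1\<close> conditions
    are imposed.\<close>
  define G :: "(real ^ 'v) set" where "G = insert ones ((\<lambda>i. \<chi> v. f v i) ` {..<m})"
  have "dim (span G) \<le> card G" by (simp add: G_def dim_le_card')
  also have "\<dots> \<le> m + 1" unfolding G_def
    by (metis Suc_eq_plus1 Suc_le_mono card_image_le card_insert_le_m1 card_lessThan
        diff_Suc_1 finite_lessThan le_SucI card_insert_if finite_imageI)
  finally have dG: "dim (span G) \<le> m + 1" .
  have "dim {y \<in> UNIV. \<forall>x\<in>span G. orthogonal x y} + dim (span G) = CARD('v)"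
    by (subst dim_subspace_orthogonal_to_vectors) auto
  moreover have "{y \<in> UNIV. \<forall>x\<in>span G. orthogonal x y} \<subseteq> null_on sum_zero (shift (adjacency E) c)"
  proof
    fix y assume "y \<in> {y \<in> UNIV. \<forall>x\<in>span G. orthogonal x y}"
    then have o: "\<And>x. x \<in> G \<Longrightarrow> x \<bullet> y = 0"
      by (auto simp: span_base orthogonal_def)
    then have y: "y \<in> sum_zero" by (simp add: sum_zero_def G_def inner_commute)
    moreover have "y \<bullet> (\<chi> v. f v i) = 0" if "i < m" for i
      using o[of "\<chi> v. f v i"] that by (simp add: G_def inner_commute)
    ultimately have "(\<beta>\<^sup>2 - \<alpha>\<^sup>2) * (y \<bullet> shift (adjacency E) c y) = 0"
      by (simp add: form)
    then show "y \<in> null_on sum_zero (shift (adjacency E) c)"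
      using d y by (simp add: null_on_def)
  qed
  ultimately have "CARD('v) - 1 - m \<le> dim (null_on sum_zero (shift (adjacency E) c))"
    using dG dim_subset by (metis (no_types, lifting) add_le_cancel_left diff_diff_left add.commute le_diff_conv le_trans)
  then show ?thesis using c1 nn by (auto simp: attains_nullity_def)
qed

text \<open>The squared distances are the values of the form at \<open>e\<^sub>u - e\<^sub>v\<close>: \<open>2 c\<close> for non-adjacent and
  \<open>2 (c - 1)\<close> for adjacent vertices.\<close>

lemma representable_of_attains_nullity:
  fixes E :: "'v::finite \<Rightarrow> 'v \<Rightarrow> bool"
  assumes E: "simple_graph E" and k: "attains_nullity E (CARD('v) - 1 - m)"
  shows "representable E m"
proof -
  obtain c where c: "c > 1" and nn: "nonneg_on sum_zero (shift (adjacency E) c)"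
    and d: "CARD('v) - 1 - m \<le> dim (null_on sum_zero (shift (adjacency E) c))"
    using k unfolding attains_nullity_def by blast
  then have "dim (sum_zero :: (real ^ 'v) set) \<le> dim (null_on sum_zero (shift (adjacency E) c)) + m"
    using dim_sum_zero[where 'v = 'v] by linarith
  \<comment> \<open>The vectors \<open>g i\<close> serve as the coordinate functions of the
    representation.\<close>
  then obtain g where g: "\<And>x. x \<in> sum_zero \<Longrightarrow> x \<bullet> shift (adjacency E) c x = (\<Sum>i<m. (x \<bullet> g i)\<^sup>2)"
    using nonneg_on_sum_of_squares[OF self_adjoint_shift[OF symmetric_adjacency[OF E]] subspace_sum_zero nn]
    by metis
  have "(\<Sum>i<m. (g i $ u - g i $ v)\<^sup>2) = (if E u v then 2 * (c - 1) else 2 * c)" if uv: "u \<noteq> v" for u v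
  proof -
    let ?x = "axis u 1 - axis v (1 :: real)"
    have x: "?x \<in> sum_zero"
      by (simp add: sum_zero_def inner_diff_left inner_axis' ones_def)
    have "(\<Sum>i<m. (g i $ u - g i $ v)\<^sup>2) = (\<Sum>i<m. (?x \<bullet> g i)\<^sup>2)"
      by (simp add: inner_diff_left inner_axis')
    also have "\<dots> = ?x \<bullet> shift (adjacency E) c ?x" using g[OF x] by simp
    also have "\<dots> = (if E u v then 2 * (c - 1) else 2 * c)"
    proof -
      have E': "E u v = E v u" "\<not> E u u" "\<not> E v v"
        using E by (auto simp: simple_graph_def symp_def irreflp_def)
      show ?thesis using uv E'
        by (simp add: inner_shift inner_diff_left inner_diff_right inner_axis' matrix_vector_mult_diff_distrib
            matrix_vector_mult_basis column_def adjacency_def inner_axis axis_component)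
    qed
    finally show ?thesis .
  qed
  then show ?thesis
    unfolding representable_def L2_set_def
    using c by (intro exI[of _ "\<lambda>v i. g i $ v"] exI[of _ "sqrt (2 * (c - 1))"] exI[of _ "sqrt (2 * c)"]) simp
qed

text \<open>Complementing swaps the two distances, so adjacent vertices are at the shorter distance
  either in the graph or in its complement.\<close>

lemma representable_iff:
  fixes E :: "'v::finite \<Rightarrow> 'v \<Rightarrow> bool"
  assumes E: "simple_graph E"
  shows "representable E m \<longleftrightarrow>
    attains_nullity E (CARD('v) - 1 - m) \<or> attains_nullity (complement E) (CARD('v) - 1 - m)"
proof
  note E' = simple_graph_complement[OF E]
  assume "representable E m"
  then obtain f \<alpha> \<beta> where *: "0 < \<alpha>" "0 < \<beta>" "\<alpha> \<noteq> \<beta>"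
    "\<And>u v. u \<noteq> v \<Longrightarrow> L2_set (\<lambda>i. f u i - f v i) {..<m} = (if E u v then \<alpha> else \<beta>)"
    unfolding representable_def by blast
  show "attains_nullity E (CARD('v) - 1 - m) \<or> attains_nullity (complement E) (CARD('v) - 1 - m)"
  proof (cases "\<alpha> < \<beta>")
    case True
    then show ?thesis using attains_nullity_of_representable[OF E] * by blast
  next
    case False
    then have "\<beta> < \<alpha>" using * by simp
    moreover have "L2_set (\<lambda>i. f u i - f v i) {..<m} = (if complement E u v then \<beta> else \<alpha>)"
      if "u \<noteq> v" for u v
      using *(4)[OF that] that by (simp add: complement_def)
    ultimately show ?thesis using attains_nullity_of_representable[OF E'] * by blast
  qed
next
  assume "attains_nullity E (CARD('v) - 1 - m) \<or> attains_nullity (complement E) (CARD('v) - 1 - m)"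
  then show "representable E m"
    using representable_of_attains_nullity[OF E] representable_complement[OF simple_graph_complement[OF E]]
      representable_of_attains_nullity[OF simple_graph_complement[OF E]] complement_complement[OF E] by metis
qed

text \<open>Being a relation rather than a maximum, it says that the attained nullities are exactly
  0, ..., \<open>k\<close>, without presupposing that a largest one exists.\<close>

definition max_nullity :: "('v::finite \<Rightarrow> 'v \<Rightarrow> bool) \<Rightarrow> nat \<Rightarrow> bool" where
  "max_nullity E k \<longleftrightarrow> (\<forall>l. attains_nullity E l \<longleftrightarrow> l \<le> k)"

lemma Rep_eq:
  fixes E :: "'v::finite \<Rightarrow> 'v \<Rightarrow> bool"
  assumes E: "simple_graph E" and k: "max_nullity E k" and k': "max_nullity (complement E) k'"
  shows "int (Rep E) = int CARD('v) - 1 - int (max k k')"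
proof -
  \<comment> \<open>This bound keeps the natural-number subtraction in the value of
    \<open>Rep\<close> from being truncated.\<close>
  have "k \<le> CARD('v) - 1" "k' \<le> CARD('v) - 1"
    if "attains_nullity E k" "attains_nullity (complement E) k'"
    using that dim_sum_zero[where 'v = 'v] unfolding attains_nullity_def
    by (metis (no_types, lifting) dim_subset le_trans null_on_def mem_Collect_eq subsetI)+
  then have le: "max k k' \<le> CARD('v) - 1" using k k' by (simp add: max_nullity_def)
  have r: "representable E m \<longleftrightarrow> CARD('v) - 1 - m \<le> max k k'" for m
    using k k' by (auto simp: representable_iff[OF E] max_nullity_def)
  have "Rep E = CARD('v) - 1 - max k k'"
    unfolding Rep_def by (rule Least_equality) (auto simp: r)
  moreover have "0 < CARD('v)" by simp
  ultimately show ?thesis using le by linarith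
qed

section \<open>The critical shift: uniqueness and existence\<close>

lemma nonneg_on_shift_mono:
  assumes "nonneg_on S (shift A c)" "c \<le> d"
  shows "nonneg_on S (shift A d)"
  unfolding nonneg_on_def
proof
  fix x assume "x \<in> S"
  then have "0 \<le> x \<bullet> (A *v x) + c * (x \<bullet> x)"
    using assms(1) by (simp add: nonneg_on_def inner_shift)
  moreover have "c * (x \<bullet> x) \<le> d * (x \<bullet> x)"
    using assms(2) by (simp add: mult_right_mono)
  ultimately show "0 \<le> x \<bullet> shift A d x" by (simp add: inner_shift)
qed

text \<open>Beyond a shift at which the form is nonnegative, it is positive definite and has no
  nonzero null vector.\<close>

lemma null_on_shift_le:
  assumes "nonneg_on S (shift A c)" "x \<in> null_on S (shift A d)" "x \<noteq> 0"
  shows "d \<le> c"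
proof -
  have "0 \<le> x \<bullet> (A *v x) + c * (x \<bullet> x)" "x \<bullet> (A *v x) + d * (x \<bullet> x) = 0"
    using assms by (auto simp: nonneg_on_def null_on_def inner_shift)
  then have "d * (x \<bullet> x) \<le> c * (x \<bullet> x)" by linarith
  then show ?thesis using assms(3) by (simp add: mult_le_cancel_right)
qed

lemma dim_pos_obtain:
  fixes S :: "'a::euclidean_space set"
  assumes "0 < dim S"
  obtains x where "x \<in> S" "x \<noteq> 0"
proof -
  have "\<not> S \<subseteq> {0}" using assms by (metis dim_eq_0 less_irrefl)
  then show ?thesis using that by blast
qed

text \<open>Two shifts that are both nonnegative with a nonzero null vector bound each other, hence
  coincide; every other admissible shift has nullity 0.\<close>

lemma max_nullity_pos:
  assumes c: "c > 1" and nn: "nonneg_on sum_zero (shift (adjacency E) c)"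
    and k: "k = dim (null_on sum_zero (shift (adjacency E) c))" "0 < k"
  shows "max_nullity E k"
  unfolding max_nullity_def
proof (intro allI iffI)
  fix l assume "l \<le> k"
  then show "attains_nullity E l" using c nn k by (auto simp: attains_nullity_def)
next
  fix l assume "attains_nullity E l"
  then obtain d where d: "nonneg_on sum_zero (shift (adjacency E) d)"
    "l \<le> dim (null_on sum_zero (shift (adjacency E) d))"
    by (auto simp: attains_nullity_def)
  show "l \<le> k"
  proof (cases "l = 0")
    case False
    obtain x where "x \<in> null_on sum_zero (shift (adjacency E) d)" "x \<noteq> 0"
      using False d(2) by (metis dim_pos_obtain gr0I le_zero_eq)
    then have "d \<le> c" using null_on_shift_le[OF nn] by blast
    moreover obtain y where "y \<in> null_on sum_zero (shift (adjacency E) c)" "y \<noteq> 0"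
      using k dim_pos_obtain by blast
    then have "c \<le> d" using null_on_shift_le[OF d(1)] by blast
    ultimately show ?thesis using d(2) k(1) by simp
  qed simp
qed

lemma max_nullity_0:
  assumes "nonneg_on sum_zero (shift (adjacency E) 1)"
  shows "max_nullity E 0"
  unfolding max_nullity_def
proof (intro allI iffI)
  fix l :: nat assume "l \<le> 0"
  then show "attains_nullity E l"
    \<comment> \<open>Any shift above 1 witnesses nullity 0.\<close>
    using nonneg_on_shift_mono[OF assms, of 2]
    by (auto simp: attains_nullity_def intro!: exI[of _ 2])
next
  fix l assume "attains_nullity E l"
  then obtain d where d: "d > 1" "l \<le> dim (null_on sum_zero (shift (adjacency E) d))"
    by (auto simp: attains_nullity_def)
  have "null_on sum_zero (shift (adjacency E) d) \<subseteq> {0}"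
    using null_on_shift_le[OF assms] d(1) by force
  then have "dim (null_on sum_zero (shift (adjacency E) d)) = 0" by (simp only: dim_eq_0)
  then show "l \<le> 0" using d by linarith
qed

text \<open>Here - \<open>c\<close> is the least eigenvalue of the compression to
  \<open>sum_zero\<close>. Since nonnegativity is monotone in the shift, its failure at 1 forces
  \<open>c > 1\<close>.\<close>

lemma exists_critical_shift:
  fixes A :: "real ^ 'v ^ 'v::finite"
  assumes "transpose A = A" "\<not> nonneg_on sum_zero (shift A 1)"
  obtains c where "c > 1" "nonneg_on sum_zero (shift A c)" "0 < dim (null_on sum_zero (shift A c))"
proof -
  have "sum_zero \<noteq> {0 :: real ^ 'v}"
  proof
    assume "sum_zero = {0 :: real ^ 'v}"
    then have "nonneg_on sum_zero (shift A 1)" by (metis inner_zero_left nonneg_on_def order_refl singletonD)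
    then show False using assms(2) by simp
  qed
  moreover have "linear (shift A 0)"
    using self_adjoint_shift[OF assms(1)] by (simp add: self_adjoint_def)
  ultimately obtain c x where c: "nonneg_on sum_zero (shift A c)"
    "x \<in> null_on sum_zero (shift A c)" "x \<noteq> 0"
    using exists_nonneg_shift[of "shift A 0" sum_zero] subspace_sum_zero
    by (auto simp: shift_def[abs_def])
  have "c > 1"
    using nonneg_on_shift_mono[OF c(1), of 1] assms(2) by force
  moreover have "dim (null_on sum_zero (shift A c)) \<noteq> 0"
    using c(2,3) by (auto simp: dim_eq_0)
  ultimately show ?thesis using c that by blast
qed

section \<open>Spectral decomposition\<close>

lemma orth_proj_in: "subspace S \<Longrightarrow> orth_proj S x \<in> S"
  and orth_proj_inner: "subspace S \<Longrightarrow> z \<in> S \<Longrightarrow> orth_proj S x \<bullet> z = x \<bullet> z"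
  using theI'[OF orth_proj_unique[of S x]]
  by (auto simp: orth_proj_def orthogonal_def inner_diff_left)

abbreviation eig_proj :: "real ^ 'v ^ 'v \<Rightarrow> real \<Rightarrow> real ^ 'v \<Rightarrow> real ^ 'v::finite" where
  "eig_proj A \<tau> \<equiv> orth_proj (eigenspace A \<tau>)"

lemma eig_proj_eigenspace: "A *v eig_proj A \<tau> x = \<tau> *\<^sub>R eig_proj A \<tau> x"
  using orth_proj_in[OF subspace_eigenspace, of A \<tau> x] by (simp add: eigenspace_def)

lemma inner_eig_proj: "x \<bullet> eig_proj A \<tau> x = eig_proj A \<tau> x \<bullet> eig_proj A \<tau> x"
  by (simp add: orth_proj_inner orth_proj_in subspace_eigenspace)

context
  fixes A :: "real ^ 'v ^ 'v::finite"
  assumes sym: "transpose A = A"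
begin

lemma eigenspaces_orthogonal:
  assumes "x \<in> eigenspace A \<sigma>" "y \<in> eigenspace A \<tau>" "\<sigma> \<noteq> \<tau>"
  shows "x \<bullet> y = 0"
  using matrix_vector_inner[OF sym, of x y] assms by (simp add: eigenspace_def)

text \<open>Core of the spectral theorem: the vectors orthogonal to all eigenspaces form an
  invariant subspace. Were it nonzero, the minimiser of the form on it would be an eigenvector
  orthogonal to itself.\<close>

lemma orthogonal_to_eigenspaces_eq_0:
  assumes "\<And>\<tau> z. z \<in> eigenspace A \<tau> \<Longrightarrow> y \<bullet> z = 0"
  shows "y = 0"
proof (rule ccontr)
  assume "y \<noteq> 0"
  define S where "S = {y. \<forall>\<tau>. \<forall>z\<in>eigenspace A \<tau>. y \<bullet> z = 0}"
  have S: "subspace S" by (auto simp: S_def subspace_def inner_add_left)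
  have "y \<in> S" using assms by (simp add: S_def)
  then have "S \<noteq> {0}" using \<open>y \<noteq> 0\<close> by blast
  moreover have "linear (\<lambda>x. A *v x)" by simp
  ultimately obtain c x where nn: "nonneg_on S (shift A c)"
    and x: "x \<in> null_on S (shift A c)" "x \<noteq> 0"
    using exists_nonneg_shift[of "\<lambda>x. A *v x" S] S by (auto simp: shift_def[abs_def])
  have xS: "x \<in> S" using x by (simp add: null_on_def)
  have "(A *v x) \<bullet> z = 0" if "z \<in> eigenspace A \<tau>" for \<tau> z
  proof -
    have "x \<bullet> z = 0" using xS that unfolding S_def by blast
    then show ?thesis using that by (simp add: matrix_vector_inner[OF sym] eigenspace_def)
  qed
  then have "shift A c x \<in> S"
    using xS by (auto simp: S_def shift_def inner_add_left)
  \<comment> \<open>A null vector pairs to zero with all of \<open>S\<close>, and by invariance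
    \<open>shift A c x\<close> itself belongs to \<open>S\<close>.\<close>
  then have "shift A c x \<bullet> shift A c x = 0"
    using x null_on_iff[OF self_adjoint_shift[OF sym] S nn] by blast
  then have "A *v x = (- c) *\<^sub>R x"
    by (simp add: shift_def add_eq_0_iff2)
  then have "x \<in> eigenspace A (- c)" by (simp add: eigenspace_def)
  then have "x \<bullet> x = 0" using xS unfolding S_def by blast
  then show False using x by simp
qed

lemma eigenspace_trivial: "\<tau> \<notin> eigenvalues A \<Longrightarrow> z \<in> eigenspace A \<tau> \<Longrightarrow> z = 0"
  by (auto simp: eigenvalues_def eigenspace_def)

lemma spectral_decomposition: "x = (\<Sum>\<tau>\<in>eigenvalues A. eig_proj A \<tau> x)"
proof -
  have "(x - (\<Sum>\<tau>\<in>eigenvalues A. eig_proj A \<tau> x)) \<bullet> z = 0" if z: "z \<in> eigenspace A \<sigma>" for \<sigma> z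
  proof (cases "\<sigma> \<in> eigenvalues A")
    case True
    have "(\<Sum>\<tau>\<in>eigenvalues A. eig_proj A \<tau> x) \<bullet> z = (\<Sum>\<tau>\<in>eigenvalues A. if \<tau> = \<sigma> then x \<bullet> z else 0)"
      unfolding inner_sum_left
    proof (rule sum.cong[OF refl])
      fix \<tau>
      show "eig_proj A \<tau> x \<bullet> z = (if \<tau> = \<sigma> then x \<bullet> z else 0)"
        using z eigenspaces_orthogonal[OF orth_proj_in[OF subspace_eigenspace] z, of \<tau>]
        by (auto simp: orth_proj_inner subspace_eigenspace)
    qed
    then show ?thesis
      using True finite_eigenvalues[OF sym] by (simp add: inner_diff_left)
  next
    case False
    then have "z = 0" using eigenspace_trivial z by blast
    then show ?thesis by simp
  qed
  then show ?thesis
    using orthogonal_to_eigenspaces_eq_0 by (metis right_minus_eq)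
qed

lemma spectral_form:
  "x \<bullet> shift A (- \<sigma>) x = (\<Sum>\<tau>\<in>eigenvalues A. (\<tau> - \<sigma>) * (eig_proj A \<tau> x \<bullet> eig_proj A \<tau> x))"
proof -
  have "shift A (- \<sigma>) x = (\<Sum>\<tau>\<in>eigenvalues A. (\<tau> - \<sigma>) *\<^sub>R eig_proj A \<tau> x)"
  proof -
    have "shift A (- \<sigma>) x = A *v (\<Sum>\<tau>\<in>eigenvalues A. eig_proj A \<tau> x) - \<sigma> *\<^sub>R (\<Sum>\<tau>\<in>eigenvalues A. eig_proj A \<tau> x)"
      using spectral_decomposition[of x] by (simp add: shift_def)
    also have "\<dots> = (\<Sum>\<tau>\<in>eigenvalues A. (\<tau> - \<sigma>) *\<^sub>R eig_proj A \<tau> x)"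
      by (simp add: linear_sum[OF matrix_vector_mul_linear] eig_proj_eigenspace scaleR_sum_right
          sum_subtractf[symmetric] algebra_simps)
    finally show ?thesis .
  qed
  then show ?thesis by (simp add: inner_sum_right inner_eig_proj)
qed

lemma least_eigenvalue_form:
  assumes "\<And>\<tau>. \<tau> \<in> eigenvalues A \<Longrightarrow> \<sigma> \<le> \<tau>"
  shows "nonneg_on UNIV (shift A (- \<sigma>))" "null_on UNIV (shift A (- \<sigma>)) = eigenspace A \<sigma>"
proof -
  have t: "0 \<le> (\<tau> - \<sigma>) * (eig_proj A \<tau> x \<bullet> eig_proj A \<tau> x)" if "\<tau> \<in> eigenvalues A" for \<tau> x
    using assms[OF that] by simp
  show nn: "nonneg_on UNIV (shift A (- \<sigma>))"
    unfolding nonneg_on_def spectral_form by (auto intro: sum_nonneg t)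
  show "null_on UNIV (shift A (- \<sigma>)) = eigenspace A \<sigma>"
  proof (intro set_eqI)
    fix x
    have "x \<in> null_on UNIV (shift A (- \<sigma>)) \<longleftrightarrow> (\<forall>y. y \<bullet> shift A (- \<sigma>) x = 0)"
      using null_on_iff[OF self_adjoint_shift[OF sym] subspace_UNIV nn] by simp
    also have "\<dots> \<longleftrightarrow> shift A (- \<sigma>) x = 0"
      by (metis inner_eq_zero_iff inner_zero_right)
    also have "\<dots> \<longleftrightarrow> x \<in> eigenspace A \<sigma>"
      by (simp add: shift_def eigenspace_def)
    finally show "x \<in> null_on UNIV (shift A (- \<sigma>)) \<longleftrightarrow> x \<in> eigenspace A \<sigma>" .
  qed
qed

text \<open>In the spectral expansion only the term of \<rho> can be negative, and it vanishes on
  vectors orthogonal to that eigenspace.\<close>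

lemma second_eigenvalue_form:
  assumes "\<And>\<tau>. \<tau> \<in> eigenvalues A \<Longrightarrow> \<tau> = \<rho> \<or> \<sigma> \<le> \<tau>"
  shows "nonneg_on {x. \<forall>z\<in>eigenspace A \<rho>. x \<bullet> z = 0} (shift A (- \<sigma>))"
  unfolding nonneg_on_def
proof
  fix x assume "x \<in> {x. \<forall>z\<in>eigenspace A \<rho>. x \<bullet> z = 0}"
  then have "x \<bullet> eig_proj A \<rho> x = 0"
    by (simp add: orth_proj_in subspace_eigenspace)
  then have "eig_proj A \<rho> x = 0" by (simp add: inner_eig_proj)
  then show "0 \<le> x \<bullet> shift A (- \<sigma>) x"
    unfolding spectral_form using assms by (intro sum_nonneg) force
qed

end

lemma main_angle_of_sq:
  "(main_angle_of A \<tau>)\<^sup>2 = (eig_proj A \<tau> ones \<bullet> eig_proj A \<tau> ones) / real CARD('v)"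
  for A :: "real ^ 'v ^ 'v::finite"
  by (simp add: main_angle_of_def ones_def[symmetric] power_mult_distrib power_divide dot_square_norm)

lemma main_angle_of_eq_0: "main_angle_of A \<tau> = 0 \<longleftrightarrow> eig_proj A \<tau> ones = 0"
  by (simp add: main_angle_of_def ones_def[symmetric])

lemma first_two_eigenvalues:
  assumes "transpose A = A" "2 \<le> card (eigenvalues A)"
  shows "eig A 1 \<in> eigenvalues A" "eig A 2 \<in> eigenvalues A" "eig A 1 < eig A 2"
    "\<And>\<tau>. \<tau> \<in> eigenvalues A - {eig A 1, eig A 2} \<Longrightarrow> eig A 2 < \<tau>"
    "(\<Sum>i = 3..num_eigs A. f (eig A i)) = (\<Sum>\<tau>\<in>eigenvalues A - {eig A 1, eig A 2}. f \<tau>)"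
proof -
  define L where "L = sorted_list_of_set (eigenvalues A)"
  have L: "sorted_wrt (<) L" "set L = eigenvalues A" "length L = card (eigenvalues A)"
    using finite_eigenvalues[OF assms(1)] by (simp_all add: L_def)
  obtain a b M where M: "L = a # b # M"
    using L(3) assms(2) by (metis Suc_le_length_iff numeral_2_eq_2)
  have e: "eig A 1 = a" "eig A 2 = b" by (simp_all add: eig_def L_def[symmetric] M)
  have D: "eigenvalues A - {a, b} = set M" "distinct M" using L(1,2) M
    by (auto simp: strict_sorted_iff)
  show "eig A 1 \<in> eigenvalues A" "eig A 2 \<in> eigenvalues A" "eig A 1 < eig A 2"
    "\<And>\<tau>. \<tau> \<in> eigenvalues A - {eig A 1, eig A 2} \<Longrightarrow> eig A 2 < \<tau>"
    unfolding e using L(1,2) M by auto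
  have "(\<Sum>i = 3..num_eigs A. f (eig A i)) = (\<Sum>i<length M. f (M ! i))"
    \<comment> \<open>Eigenvalue number \<open>i\<close> sits at list position \<open>i - 1\<close>;
      once \<open>a\<close> and \<open>b\<close> are removed, at position \<open>i - 3\<close> of
      \<open>M\<close>.\<close>
    by (rule sum.reindex_bij_witness[of _ "\<lambda>i. i + 3" "\<lambda>i. i - 3"])
      (use L(3) M in \<open>auto simp: num_eigs_def eig_def L_def[symmetric] numeral_3_eq_3 nth_Cons' \<close>)
  also have "\<dots> = (\<Sum>\<tau>\<in>set M. f \<tau>)"
    using D(2) by (simp add: sum_list_sum_nth[symmetric] sum.distinct_set_conv_list atLeast0LessThan sum_list_sum_nth)
  finally show "(\<Sum>i = 3..num_eigs A. f (eig A i)) = (\<Sum>\<tau>\<in>eigenvalues A - {eig A 1, eig A 2}. f \<tau>)"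
    unfolding e D(1) .
qed

section \<open>Main angles and the compressed least eigenvalue\<close>

lemma critical_shift_unique:
  assumes "nonneg_on S (shift A c)" "0 < dim (null_on S (shift A c))"
    and "nonneg_on S (shift A d)" "0 < dim (null_on S (shift A d))"
  shows "c = d"
  by (metis assms dim_pos_obtain null_on_shift_le antisym)

lemma mult_ge_1:
  assumes "eig A i \<in> eigenvalues A"
  shows "1 \<le> mult A i"
proof -
  have "\<not> eigenspace A (eig A i) \<subseteq> {0}"
    using assms by (auto simp: eigenvalues_def eigenspace_def)
  then have "dim (eigenspace A (eig A i)) \<noteq> 0" by (metis dim_eq_0)
  then show ?thesis unfolding mult_def by linarith
qed

text \<open>The last two assumptions say that - \<open>c\<close> is the least eigenvalue of the
  compression of \<open>A\<close> to \<open>sum_zero\<close>. Stated for a symmetric matrix, this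
  serves the graph and its complement alike.\<close>

locale critical_shift =
  fixes A :: "real ^ 'v ^ 'v::finite" and c :: real
  assumes sym: "transpose A = A"
    and two: "2 \<le> card (eigenvalues A)"
    and c1: "1 < c"
    and nn: "nonneg_on sum_zero (shift A c)"
    and pos: "0 < dim (null_on sum_zero (shift A c))"
begin

abbreviation "nullity \<equiv> dim (null_on sum_zero (shift A c))"
definition "\<tau>1 = eig A 1"
definition "\<tau>2 = eig A 2"
abbreviation "p \<equiv> (\<lambda>\<tau>. eig_proj A \<tau> ones)"

text \<open>This is \<open>CARD('v)\<close> times the sum over i \<ge> 3 in the definition of
  \<open>m2'\<close>.\<close>

definition "rest = (\<Sum>\<tau>\<in>eigenvalues A - {\<tau>1, \<tau>2}. (p \<tau> \<bullet> p \<tau>) / (\<tau> - \<tau>2))"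

lemmas eigs = first_two_eigenvalues[OF sym two, folded \<tau>1_def \<tau>2_def]

lemma p_eigenspace: "p \<tau> \<in> eigenspace A \<tau>"
  by (simp add: orth_proj_in subspace_eigenspace)

lemma p_inner_ones: "p \<tau> \<bullet> ones = p \<tau> \<bullet> p \<tau>"
  using inner_eig_proj[of ones A \<tau>] by (simp add: inner_commute)

lemma p_inner: "x \<in> eigenspace A \<tau> \<Longrightarrow> x \<bullet> p \<tau> = x \<bullet> ones"
  by (metis inner_commute orth_proj_inner subspace_eigenspace)

text \<open>Eigenvectors have the same inner product with \<open>ones\<close> as with its
  projection, so a vanishing main angle puts the whole eigenspace into the hyperplane.\<close>

lemma eigenspace_sum_zero: "p \<tau> = 0 \<Longrightarrow> eigenspace A \<tau> \<subseteq> sum_zero"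
  using p_inner by (fastforce simp: sum_zero_def)

lemma form_eigenspace: "x \<in> eigenspace A \<tau> \<Longrightarrow> shift A (- \<sigma>) x = (\<tau> - \<sigma>) *\<^sub>R x"
  by (simp add: eigenspace_def shift_def algebra_simps)

lemma least_form:
  shows "nonneg_on sum_zero (shift A (- \<tau>1))"
    and "null_on sum_zero (shift A (- \<tau>1)) = eigenspace A \<tau>1 \<inter> sum_zero"
proof -
  have "\<tau>1 \<le> \<tau>" if "\<tau> \<in> eigenvalues A" for \<tau>
    using eigs(3,4) that by fastforce
  note * = least_eigenvalue_form[OF sym this]
  show "nonneg_on sum_zero (shift A (- \<tau>1))"
    using *(1) by (simp add: nonneg_on_def)
  show "null_on sum_zero (shift A (- \<tau>1)) = eigenspace A \<tau>1 \<inter> sum_zero"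
    using *(2) by (auto simp: null_on_def)
qed

lemma second_form:
  assumes "\<And>z. z \<in> eigenspace A \<tau>1 \<Longrightarrow> x \<bullet> z = 0"
  shows "0 \<le> x \<bullet> shift A (- \<tau>2) x"
proof -
  have "nonneg_on {x. \<forall>z\<in>eigenspace A \<tau>1. x \<bullet> z = 0} (shift A (- \<tau>2))"
    by (rule second_eigenvalue_form[OF sym]) (use eigs(4) in force)
  then show ?thesis using assms by (auto simp: nonneg_on_def)
qed

lemma rest_term_nonneg:
  "\<tau> \<in> eigenvalues A - {\<tau>1, \<tau>2} \<Longrightarrow> 0 \<le> (p \<tau> \<bullet> p \<tau>) / (\<tau> - \<tau>2)"
  using eigs(4) by (simp add: less_imp_le)

lemma ones_decomposition:
  "ones = p \<tau>1 + p \<tau>2 + (\<Sum>\<tau>\<in>eigenvalues A - {\<tau>1, \<tau>2}. p \<tau>)"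
proof -
  have "eigenvalues A = insert \<tau>1 (insert \<tau>2 (eigenvalues A - {\<tau>1, \<tau>2}))"
    using eigs(1,2) by blast
  then have "(\<Sum>\<tau>\<in>eigenvalues A. p \<tau>) = (\<Sum>\<tau>\<in>insert \<tau>1 (insert \<tau>2 (eigenvalues A - {\<tau>1, \<tau>2})). p \<tau>)"
    by simp
  also have "\<dots> = p \<tau>1 + p \<tau>2 + (\<Sum>\<tau>\<in>eigenvalues A - {\<tau>1, \<tau>2}. p \<tau>)"
    using eigs(3) finite_eigenvalues[OF sym] by simp
  finally show ?thesis using spectral_decomposition[OF sym, of ones] by simp
qed

text \<open>All terms of \<open>rest\<close> are nonnegative; if they all vanished,
  \<open>ones\<close> would have no spectral component left. This rules out a nonzero
  \<open>m2'\<close> when the first main angle is 0.\<close>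

lemma rest_pos:
  assumes "p \<tau>1 = 0" "p \<tau>2 = 0"
  shows "0 < rest"
proof (rule ccontr)
  assume "\<not> 0 < rest"
  moreover have "0 \<le> rest"
    unfolding rest_def by (intro sum_nonneg rest_term_nonneg)
  ultimately have "rest = 0" by simp
  then have "\<forall>\<tau>\<in>eigenvalues A - {\<tau>1, \<tau>2}. (p \<tau> \<bullet> p \<tau>) / (\<tau> - \<tau>2) = 0"
    unfolding rest_def using finite_eigenvalues[OF sym] rest_term_nonneg
    by (subst (asm) sum_nonneg_eq_0_iff) auto
  then have "\<forall>\<tau>\<in>eigenvalues A - {\<tau>1, \<tau>2}. p \<tau> = 0"
    using eigs(4) by force
  then have "ones = (0 :: real ^ 'v)"
    using ones_decomposition assms by simp
  then show False using ones_nonzero by blast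
qed

lemma m1'_eq: "m1' A = (if p \<tau>1 = 0 then mult A 1 + 1 else mult A 1)"
  by (simp add: m1'_def main_angle_def main_angle_of_eq_0 \<tau>1_def)

lemma m2'_eq:
  "m2' A = (if \<tau>2 < -1 \<and> mult A 1 = 1 \<and> p \<tau>2 = 0 \<and> (p \<tau>1 \<bullet> p \<tau>1) / (\<tau>2 - \<tau>1) = rest then mult A 2 + 2
     else if \<tau>2 < -1 \<and> mult A 1 = 1 \<and> p \<tau>2 = 0 \<and> (p \<tau>1 \<bullet> p \<tau>1) / (\<tau>2 - \<tau>1) > rest then mult A 2 + 1
     else 0)"
proof -
  let ?n = "real CARD('v)"
  have l: "(main_angle A 1)\<^sup>2 / (\<tau>2 - \<tau>1) = ((p \<tau>1 \<bullet> p \<tau>1) / (\<tau>2 - \<tau>1)) / ?n"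
    by (simp add: main_angle_def main_angle_of_sq \<tau>1_def)
  have r: "(\<Sum>i = 3..num_eigs A. (main_angle A i)\<^sup>2 / (eig A i - \<tau>2)) = rest / ?n"
    unfolding main_angle_def main_angle_of_sq rest_def
    by (subst eigs(5)[where f = "\<lambda>\<tau>. p \<tau> \<bullet> p \<tau> / ?n / (\<tau> - \<tau>2)"])
      (simp add: sum_divide_distrib field_simps)
  have n: "a / ?n = b / ?n \<longleftrightarrow> a = b" "a / ?n < b / ?n \<longleftrightarrow> a < b" for a b
    by (simp_all add: divide_less_cancel)
  have p: "main_angle A 2 = 0 \<longleftrightarrow> p \<tau>2 = 0"
    by (simp add: main_angle_def main_angle_of_eq_0 \<tau>2_def)
  show ?thesis
    unfolding m2'_def Let_def \<tau>1_def[symmetric] \<tau>2_def[symmetric] l r n p ..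
qed

text \<open>A one-dimensional eigenspace is spanned by the nonzero vector
  \<open>p \<tau>1\<close>.\<close>

lemma perp_if_simple:
  assumes m: "mult A 1 = 1" and p1: "p \<tau>1 \<noteq> 0"
    and x: "x \<bullet> p \<tau>1 = 0" and z: "z \<in> eigenspace A \<tau>1"
  shows "x \<bullet> z = 0"
proof -
  have "dim (eigenspace A \<tau>1 \<inter> {x. x \<bullet> p \<tau>1 = 0}) = 0"
  using dim_Int_hyperplane[OF subspace_eigenspace p_eigenspace, of \<tau>1 "p \<tau>1"] m p1
  by (simp add: mult_def \<tau>1_def)
  then have E0: "eigenspace A \<tau>1 \<inter> {x. x \<bullet> p \<tau>1 = 0} \<subseteq> {0}" by (simp only: dim_eq_0)
  define y where "y = z - ((z \<bullet> p \<tau>1) / (p \<tau>1 \<bullet> p \<tau>1)) *\<^sub>R p \<tau>1"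
  have "y \<in> eigenspace A \<tau>1"
    unfolding y_def
    by (intro subspace_diff subspace_scale subspace_eigenspace z p_eigenspace)
  moreover have "y \<bullet> p \<tau>1 = 0" using p1 by (simp add: y_def inner_diff_left)
  ultimately have "y = 0" using E0 by blast
  then have "z = ((z \<bullet> p \<tau>1) / (p \<tau>1 \<bullet> p \<tau>1)) *\<^sub>R p \<tau>1" by (simp add: y_def)
  then show ?thesis using x by (metis inner_scaleR_right mult_zero_right)
qed

text \<open>Failure at - \<tau>2 forces c > - \<tau>2, and then the form is positive definite on the
  complement of \<open>p \<tau>1\<close>. So the null space meets that hyperplane only in 0.\<close>

lemma nullity_eq_1:
  assumes m: "mult A 1 = 1" and p1: "p \<tau>1 \<noteq> 0"
    and neg: "\<not> nonneg_on sum_zero (shift A (- \<tau>2))"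
  shows "nullity = 1"
proof -
  have c: "- \<tau>2 < c"
    using neg nonneg_on_shift_mono[OF nn, of "- \<tau>2"] by linarith
  have "null_on sum_zero (shift A c) \<inter> {x. x \<bullet> p \<tau>1 = 0} \<subseteq> {0}"
  proof
    fix x assume x: "x \<in> null_on sum_zero (shift A c) \<inter> {x. x \<bullet> p \<tau>1 = 0}"
    then have "0 \<le> x \<bullet> shift A (- \<tau>2) x" using second_form perp_if_simple[OF m p1] by blast
    moreover have "x \<bullet> shift A c x = 0" using x by (simp add: null_on_def)
    ultimately have "(c + \<tau>2) * (x \<bullet> x) \<le> 0" by (simp add: inner_shift algebra_simps)
    then have "x \<bullet> x \<le> 0" using c by (simp add: mult_le_0_iff)
    then have "x \<bullet> x = 0" using inner_ge_zero[of x] by linarith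
    then show "x \<in> {0}" by simp
  qed
  then have "dim (null_on sum_zero (shift A c) \<inter> {x. x \<bullet> p \<tau>1 = 0}) = 0" by (simp only: dim_eq_0)
  then show ?thesis
    using dim_Int_hyperplane_ge[OF subspace_null_on[OF self_adjoint_shift[OF sym] subspace_sum_zero nn], of "p \<tau>1"]
      pos by linarith
qed

lemma not_nonneg_if_second_main:
  assumes p1: "p \<tau>1 \<noteq> 0" and p2: "p \<tau>2 \<noteq> 0"
  shows "\<not> nonneg_on sum_zero (shift A (- \<tau>2))"
proof
  assume *: "nonneg_on sum_zero (shift A (- \<tau>2))"
  let ?a = "p \<tau>1 \<bullet> p \<tau>1" and ?b = "p \<tau>2 \<bullet> p \<tau>2"
  \<comment> \<open>The coordinate sum of \<open>p \<tau>\<close> is its squared norm, so these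
    coefficients make \<open>x\<close> a vector of \<open>sum_zero\<close>; only its \<tau>1
    component contributes to the form.\<close>
  define x where "x = ?b *\<^sub>R p \<tau>1 - ?a *\<^sub>R p \<tau>2"
  have o: "p \<tau>2 \<bullet> p \<tau>1 = 0"
    using eigenspaces_orthogonal[OF sym p_eigenspace p_eigenspace] eigs(3) by force
  have "x \<in> sum_zero"
    by (simp add: x_def sum_zero_def inner_diff_left p_inner_ones)
  then have "0 \<le> x \<bullet> shift A (- \<tau>2) x" using * by (simp add: nonneg_on_def)
  moreover have "linear (shift A (- \<tau>2))"
    using self_adjoint_shift[OF sym] by (simp add: self_adjoint_def)
  then have "shift A (- \<tau>2) x = (?b * (\<tau>1 - \<tau>2)) *\<^sub>R p \<tau>1"
    by (simp add: x_def linear_diff linear_scale form_eigenspace[OF p_eigenspace])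
  ultimately have "0 \<le> ?b * ?b * ?a * (\<tau>1 - \<tau>2)"
    using o by (simp add: x_def inner_diff_left ac_simps)
  moreover have "0 < ?b * ?b * ?a" using p1 p2 by simp
  then have "?b * ?b * ?a * (\<tau>1 - \<tau>2) < 0" using eigs(3) by (intro mult_pos_neg) simp_all
  ultimately show False by linarith
qed

text \<open>The pseudo-inverse of A - \<tau>2 I applied to \<open>ones\<close>; it solves the
  equation exactly when \<open>ones\<close> has no \<tau>2 component.\<close>

definition "w = (\<Sum>\<tau>\<in>eigenvalues A - {\<tau>2}. (1 / (\<tau> - \<tau>2)) *\<^sub>R p \<tau>)"

lemma shift_w:
  assumes "p \<tau>2 = 0"
  shows "shift A (- \<tau>2) w = ones"
proof -
  have lin: "linear (shift A (- \<tau>2))"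
    using self_adjoint_shift[OF sym] by (simp add: self_adjoint_def)
  have "shift A (- \<tau>2) w = (\<Sum>\<tau>\<in>eigenvalues A - {\<tau>2}. p \<tau>)"
    unfolding w_def linear_sum[OF lin] linear_scale[OF lin] form_eigenspace[OF p_eigenspace]
    by (rule sum.cong[OF refl]) simp
  also have "\<dots> = (\<Sum>\<tau>\<in>eigenvalues A. p \<tau>)"
    using assms finite_eigenvalues[OF sym] by (intro sum.mono_neutral_left) auto
  also have "\<dots> = ones" using spectral_decomposition[OF sym, of ones] by simp
  finally show ?thesis .
qed

text \<open>Zero corresponds to the equality case of \<open>m2'\<close>, a negative value to its
  strict case.\<close>

lemma w_inner_ones: "w \<bullet> ones = rest - (p \<tau>1 \<bullet> p \<tau>1) / (\<tau>2 - \<tau>1)"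
proof -
  have "eigenvalues A - {\<tau>2} = insert \<tau>1 (eigenvalues A - {\<tau>1, \<tau>2})"
    using eigs(1,3) by auto
  then have "w \<bullet> ones = (\<Sum>\<tau>\<in>insert \<tau>1 (eigenvalues A - {\<tau>1, \<tau>2}). (p \<tau> \<bullet> p \<tau>) / (\<tau> - \<tau>2))"
    unfolding w_def inner_sum_left by (simp only: inner_scaleR_left p_inner_ones times_divide_eq_left mult_1)
  also have "\<dots> = (p \<tau>1 \<bullet> p \<tau>1) / (\<tau>1 - \<tau>2) + rest"
    unfolding rest_def using finite_eigenvalues[OF sym] by (subst sum.insert) auto
  finally have "w \<bullet> ones = (p \<tau>1 \<bullet> p \<tau>1) / (\<tau>1 - \<tau>2) + rest" .
  moreover have "(p \<tau>1 \<bullet> p \<tau>1) / (\<tau>1 - \<tau>2) = - ((p \<tau>1 \<bullet> p \<tau>1) / (\<tau>2 - \<tau>1))"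
    using eigs(3) by (simp add: field_simps)
  ultimately show ?thesis by linarith
qed

lemma ones_inner_p1:
  assumes "p \<tau>2 = 0"
  shows "p \<tau>1 \<bullet> p \<tau>1 = (\<tau>1 - \<tau>2) * (w \<bullet> p \<tau>1)"
proof -
  have "p \<tau>1 \<bullet> p \<tau>1 = shift A (- \<tau>2) w \<bullet> p \<tau>1"
    unfolding shift_w[OF assms] using p_inner_ones[of \<tau>1] by (simp only: inner_commute)
  also have "\<dots> = w \<bullet> shift A (- \<tau>2) (p \<tau>1)"
    using self_adjoint_shift[OF sym] by (simp add: self_adjoint_def)
  finally show ?thesis by (simp add: form_eigenspace[OF p_eigenspace])
qed

text \<open>Moving \<open>p \<tau>1\<close> along \<open>w\<close> into the hyperplane gives a
  vector at which the form is a sum of two negative terms.\<close>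

lemma not_nonneg_if_w_pos:
  assumes p1: "p \<tau>1 \<noteq> 0" and p2: "p \<tau>2 = 0" and w: "0 < w \<bullet> ones"
  shows "\<not> nonneg_on sum_zero (shift A (- \<tau>2))"
proof
  assume *: "nonneg_on sum_zero (shift A (- \<tau>2))"
  let ?a = "p \<tau>1 \<bullet> p \<tau>1"
  define t where "t = ?a / (w \<bullet> ones)"
  have "p \<tau>1 + (- t) *\<^sub>R w \<in> sum_zero"
    using w by (simp add: sum_zero_def inner_diff_left p_inner_ones t_def)
  then have "0 \<le> (p \<tau>1 + (- t) *\<^sub>R w) \<bullet> shift A (- \<tau>2) (p \<tau>1 + (- t) *\<^sub>R w)"
    using * unfolding nonneg_on_def by blast
  also have "\<dots> = (\<tau>1 - \<tau>2) * ?a - 2 * t * ((\<tau>1 - \<tau>2) * (w \<bullet> p \<tau>1)) + t\<^sup>2 * (w \<bullet> ones)"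
    unfolding self_adjoint_form_add[OF self_adjoint_shift[OF sym]]
    by (simp add: form_eigenspace[OF p_eigenspace] shift_w[OF p2])
  also have "\<dots> = (\<tau>1 - \<tau>2) * ?a - ?a * t"
    unfolding ones_inner_p1[OF p2, symmetric] using w by (simp add: t_def power2_eq_square)
  finally have "0 \<le> (\<tau>1 - \<tau>2) * ?a - ?a * t" .
  moreover have "0 < ?a" using p1 by simp
  moreover have "0 < t" using w p1 by (simp add: t_def)
  ultimately show False using eigs(3) mult_neg_pos[of "\<tau>1 - \<tau>2" ?a] mult_pos_pos[of ?a t] by linarith
qed

text \<open>With respect to the form, \<open>sum_zero\<close> is the orthogonal complement of \<open>w\<close>.  As the only negative
  direction is \<open>p \<tau>1\<close>, the form is nonnegative on that complement as soon as it is nonpositive at \<open>w\<close>.\<close>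

lemma nonneg_if_w_nonpos:
  assumes m: "\<And>x z. x \<bullet> p \<tau>1 = 0 \<Longrightarrow> z \<in> eigenspace A \<tau>1 \<Longrightarrow> x \<bullet> z = 0"
    and p1: "p \<tau>1 \<noteq> 0" and p2: "p \<tau>2 = 0" and w: "w \<bullet> ones \<le> 0"
  shows "nonneg_on sum_zero (shift A (- \<tau>2))"
  unfolding nonneg_on_def
proof
  fix x :: "real ^ 'v" assume x: "x \<in> sum_zero"
  have wp: "w \<bullet> p \<tau>1 \<noteq> 0" using ones_inner_p1[OF p2] p1 by auto
  \<comment> \<open>This makes \<open>x + t *\<^sub>R w\<close> orthogonal to
    \<open>p \<tau>1\<close>, where the form is known to be nonnegative.\<close>
  define t where "t = - (x \<bullet> p \<tau>1) / (w \<bullet> p \<tau>1)"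
  have "(x + t *\<^sub>R w) \<bullet> p \<tau>1 = 0" using wp by (simp add: inner_diff_left t_def)
  then have "0 \<le> (x + t *\<^sub>R w) \<bullet> shift A (- \<tau>2) (x + t *\<^sub>R w)"
    using second_form m by blast
  also have "\<dots> = x \<bullet> shift A (- \<tau>2) x + t\<^sup>2 * (w \<bullet> ones)"
  proof -
    have "w \<bullet> shift A (- \<tau>2) x = shift A (- \<tau>2) w \<bullet> x"
      using self_adjoint_shift[OF sym] by (simp add: self_adjoint_def)
    also have "\<dots> = 0" using x by (simp add: shift_w[OF p2] sum_zero_def inner_commute)
    finally show ?thesis
      unfolding self_adjoint_form_add[OF self_adjoint_shift[OF sym]] by (simp add: shift_w[OF p2])
  qed
  finally show "0 \<le> x \<bullet> shift A (- \<tau>2) x"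
    using w mult_nonneg_nonpos[of "t\<^sup>2" "w \<bullet> ones"] by simp
qed

text \<open>A vector \<open>x\<close> is null iff it lies in \<open>sum_zero\<close> and its image
  under A - \<tau>2 I is a multiple of \<open>ones\<close>, so it differs from a multiple of
  \<open>w\<close> by an eigenvector. Since the eigenspace lies in \<open>sum_zero\<close>,
  \<open>w\<close> can take part only if its own coordinate sum is 0.\<close>

lemma null_second:
  assumes p2: "p \<tau>2 = 0" and nn2: "nonneg_on sum_zero (shift A (- \<tau>2))"
  shows "null_on sum_zero (shift A (- \<tau>2)) =
    (if w \<bullet> ones = 0 then span (insert w (eigenspace A \<tau>2)) else eigenspace A \<tau>2)" (is "?N = ?R")
proof -
  have sa: "self_adjoint (shift A (- \<tau>2))" by (rule self_adjoint_shift[OF sym])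
  have lin: "linear (shift A (- \<tau>2))" using sa by (simp add: self_adjoint_def)
  have sub: "subspace ?N" by (rule subspace_null_on[OF sa subspace_sum_zero nn2])
  have E2: "eigenspace A \<tau>2 \<subseteq> ?N"
    using eigenspace_sum_zero[OF p2] form_eigenspace[of _ \<tau>2 \<tau>2] by (auto simp: null_on_def)
  have wN: "w \<in> ?N" if "w \<bullet> ones = 0"
    using that by (simp add: null_on_def sum_zero_def shift_w[OF p2])
  have 1: "\<exists>\<mu>. x - \<mu> *\<^sub>R w \<in> eigenspace A \<tau>2" if x: "x \<in> ?N" for x
  proof -
    let ?y = "shift A (- \<tau>2) x"
    \<comment> \<open>Coefficient of the projection of \<open>?y\<close> to the line of
      \<open>ones\<close>; the remainder lies in \<open>sum_zero\<close> and is shown to be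
      orthogonal to itself.\<close>
    define \<mu> where "\<mu> = (?y \<bullet> ones) / (ones \<bullet> (ones :: real ^ 'v))"
    have "?y - \<mu> *\<^sub>R ones \<in> sum_zero"
      using ones_nonzero[where 'v = 'v] by (simp add: sum_zero_def inner_diff_left \<mu>_def)
    moreover from this have "(?y - \<mu> *\<^sub>R ones) \<bullet> ?y = 0"
      using x null_on_iff[OF sa subspace_sum_zero nn2] by blast
    ultimately have "(?y - \<mu> *\<^sub>R ones) \<bullet> (?y - \<mu> *\<^sub>R ones) = 0"
      unfolding inner_diff_right by (simp add: sum_zero_def)
    then have "?y = \<mu> *\<^sub>R ones" by simp
    then have "shift A (- \<tau>2) (x - \<mu> *\<^sub>R w) = 0"
      by (simp add: linear_diff[OF lin] linear_scale[OF lin] shift_w[OF p2])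
    then show ?thesis by (auto simp: shift_def eigenspace_def)
  qed
  show ?thesis
  proof (cases "w \<bullet> ones = 0")
    case True
    have "?N \<subseteq> span (insert w (eigenspace A \<tau>2))"
      using 1 by (meson in_span_insert span_base span_breakdown_eq subsetI)
    moreover have "span (insert w (eigenspace A \<tau>2)) \<subseteq> ?N"
      using sub E2 wN[OF True] by (intro span_minimal) auto
    ultimately show ?thesis using True by simp
  next
    case False
    have "x \<in> eigenspace A \<tau>2" if x: "x \<in> ?N" for x
    proof -
      obtain \<mu> where \<mu>: "x - \<mu> *\<^sub>R w \<in> eigenspace A \<tau>2" using 1[OF x] by blast
      then have "(x - \<mu> *\<^sub>R w) \<bullet> ones = 0"
        using eigenspace_sum_zero[OF p2] by (auto simp: sum_zero_def)
      moreover have "x \<bullet> ones = 0" using x by (simp add: null_on_def sum_zero_def)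
      ultimately have "\<mu> = 0" using False by (simp add: inner_diff_left)
      then show ?thesis using \<mu> by simp
    qed
    then show ?thesis using E2 False by auto
  qed
qed

lemma nullity_unique:
  assumes "nonneg_on sum_zero (shift A d)" "0 < dim (null_on sum_zero (shift A d))"
  shows "nullity = dim (null_on sum_zero (shift A d))"
  using critical_shift_unique[OF nn pos assms] by simp

text \<open>The eigenspace makes - \<tau>2 a critical shift, hence equal to \<open>c > 1\<close>. In
  the equality case \<open>w\<close> lies outside the eigenspace and adds one dimension.\<close>

lemma nullity_second:
  assumes p2: "p \<tau>2 = 0" and nn2: "nonneg_on sum_zero (shift A (- \<tau>2))"
  shows "\<tau>2 < - 1" "nullity = (if w \<bullet> ones = 0 then mult A 2 + 1 else mult A 2)"
proof -
  have "w \<notin> eigenspace A \<tau>2"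
    using shift_w[OF p2] ones_nonzero[where 'v = 'v] by (auto simp: form_eigenspace)
  then have "w \<notin> span (eigenspace A \<tau>2)"
    by (metis span_eq_iff subspace_eigenspace)
  then have d: "dim (null_on sum_zero (shift A (- \<tau>2))) = (if w \<bullet> ones = 0 then mult A 2 + 1 else mult A 2)"
    unfolding null_second[OF assms] by (simp add: dim_insert mult_def \<tau>2_def)
  moreover have "1 \<le> mult A 2" using mult_ge_1 eigs(2) by (simp add: \<tau>2_def)
  ultimately have pos2: "0 < dim (null_on sum_zero (shift A (- \<tau>2)))" by simp
  show "\<tau>2 < - 1" using critical_shift_unique[OF nn pos nn2 pos2] c1 by simp
  show "nullity = (if w \<bullet> ones = 0 then mult A 2 + 1 else mult A 2)"
    using nullity_unique[OF nn2 pos2] d by simp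
qed

text \<open>The added 1 is the codimension of \<open>sum_zero\<close>. The nullity is m1 if the
  first main angle is 0, and m1 - 1 if it is not but m1 \<ge> 2; otherwise m1 = 1 and \<tau>2
  decides.\<close>

lemma main_angles_nullity: "nullity + 1 = Max {m1' A, m2' A, 2}"
proof -
  have m: "mult A 1 = dim (eigenspace A \<tau>1)" by (simp only: mult_def \<tau>1_def)
  have mult1: "1 \<le> mult A 1" using mult_ge_1 eigs(1) by (simp add: \<tau>1_def)
  have Max_eq: "Max {m1' A, m2' A, 2} = max (m1' A) (max (m2' A) 2)" by simp
  consider (a) "p \<tau>1 = 0" | (b) "p \<tau>1 \<noteq> 0" "2 \<le> mult A 1" | (c) "p \<tau>1 \<noteq> 0" "mult A 1 = 1"
    using mult1 by linarith
  then show ?thesis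
  proof cases
    case a
    have "dim (null_on sum_zero (shift A (- \<tau>1))) = mult A 1"
      unfolding least_form(2) m using eigenspace_sum_zero[OF a] by (simp only: Int_absorb2)
    then have "nullity = mult A 1"
      using nullity_unique[OF least_form(1)] mult1 by linarith
    moreover have "m2' A = 0"
      unfolding m2'_eq using a rest_pos by auto
    moreover have "m1' A = mult A 1 + 1" unfolding m1'_eq using a by (simp only: if_True simp_thms)
    ultimately show ?thesis unfolding Max_eq using mult1 by linarith
  next
    case b
    have "mult A 1 = dim (null_on sum_zero (shift A (- \<tau>1))) + 1"
      unfolding least_form(2) m unfolding sum_zero_def
      by (rule dim_Int_hyperplane[OF subspace_eigenspace p_eigenspace]) (use b(1) in \<open>simp add: p_inner_ones\<close>)
    then have "mult A 1 = nullity + 1"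
      using nullity_unique[OF least_form(1)] b by linarith
    moreover have "m2' A = 0" unfolding m2'_eq using b(2) by auto
    moreover have "m1' A = mult A 1" unfolding m1'_eq using b by (simp only: if_False simp_thms)
    ultimately show ?thesis unfolding Max_eq using b by linarith
  next
    case c
    have m1': "m1' A = 1" unfolding m1'_eq using c by (simp only: if_False simp_thms)
    have w: "w \<bullet> ones = rest - (p \<tau>1 \<bullet> p \<tau>1) / (\<tau>2 - \<tau>1)" by (rule w_inner_ones)
    show ?thesis
    proof (cases "p \<tau>2 = 0 \<and> w \<bullet> ones \<le> 0")
      case False
      then have "\<not> nonneg_on sum_zero (shift A (- \<tau>2))"
        using not_nonneg_if_second_main[OF c(1)] not_nonneg_if_w_pos[OF c(1)] not_le by blast
      then have "nullity = 1" using nullity_eq_1 c by blast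
      moreover have "m2' A = 0" unfolding m2'_eq using False unfolding w by auto
      \<comment> \<open>Nullity 1 is the case in which the entry 2 of the maximum takes
        effect.\<close>
      ultimately show ?thesis unfolding Max_eq using m1' by linarith
    next
      case True
      then have nn2: "nonneg_on sum_zero (shift A (- \<tau>2))"
        using nonneg_if_w_nonpos[OF perp_if_simple[OF c(2,1)] c(1)] by blast
      have "m2' A = nullity + 1"
        using nullity_second[OF _ nn2] True c(2) unfolding m2'_eq w by (auto simp del: One_nat_def)
      then show ?thesis unfolding Max_eq using m1' pos by linarith
    qed
  qed
qed

end

section \<open>Disjoint unions of complete graphs\<close>

text \<open>The weights 1, -2, 1 along the path give the form the value -8 + 6.\<close>

lemma not_nonneg_if_induced_path:
  fixes E :: "'v::finite \<Rightarrow> 'v \<Rightarrow> bool"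
  assumes E: "simple_graph E" and path: "E a b" "E b d" "\<not> E a d" "a \<noteq> d"
  shows "\<not> nonneg_on sum_zero (shift (adjacency E) 1)"
proof
  assume *: "nonneg_on sum_zero (shift (adjacency E) 1)"
  have E': "E b a" "E d b" "\<not> E d a" "\<not> E a a" "\<not> E b b" "\<not> E d d" "a \<noteq> b" "b \<noteq> d"
    using E path by (auto simp: simple_graph_def symp_def irreflp_def)
  define x :: "real ^ 'v" where "x = axis a 1 - 2 *\<^sub>R axis b 1 + axis d 1"
  have "x \<in> sum_zero"
    by (simp add: x_def sum_zero_def inner_diff_left inner_add_left inner_axis' ones_def)
  then have "0 \<le> x \<bullet> shift (adjacency E) 1 x" using * by (simp add: nonneg_on_def)
  moreover have "x \<bullet> (adjacency E *v x) = - 8"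
    using path E'
    by (simp add: x_def inner_diff_left inner_add_left inner_axis' matrix_vector_mult_diff_distrib
        matrix_vector_right_distrib matrix_vector_mult_scaleR
        matrix_vector_mult_basis column_def adjacency_def inner_axis axis_component)
  moreover have "x \<bullet> x = 6"
    using path E' by (simp add: x_def inner_diff_left inner_add_left inner_diff_right inner_add_right
        inner_axis' axis_component)
  ultimately show False by (simp add: inner_shift)
qed

text \<open>With a single eigenvalue the matrix is scalar, hence 0 by its zero diagonal, and the
  form is the squared norm. This secures the existence of \<tau>2.\<close>

lemma two_eigenvalues:
  fixes E :: "'v::finite \<Rightarrow> 'v \<Rightarrow> bool"
  assumes E: "simple_graph E" and neg: "\<not> nonneg_on sum_zero (shift (adjacency E) 1)"
  shows "2 \<le> card (eigenvalues (adjacency E))"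
proof (rule ccontr)
  let ?A = "adjacency E"
  note sym = symmetric_adjacency[OF E]
  assume "\<not> 2 \<le> card (eigenvalues ?A)"
  moreover have "eigenvalues ?A \<noteq> {}"
    using spectral_decomposition[OF sym, of ones] ones_nonzero by auto
  then have "card (eigenvalues ?A) \<noteq> 0" using finite_eigenvalues[OF sym] by simp
  ultimately have "card (eigenvalues ?A) = 1" by linarith
  then obtain \<tau> where \<tau>: "eigenvalues ?A = {\<tau>}" by (auto simp: card_1_singleton_iff)
  have A: "?A *v x = \<tau> *\<^sub>R x" for x
    using spectral_decomposition[OF sym, of x] eig_proj_eigenspace[of ?A \<tau> x] by (simp add: \<tau>)
  have "\<tau> = 0"
  proof -
    fix a :: 'v
    have "(?A *v axis a 1) $ a = 0"
      using E by (simp add: matrix_vector_mult_basis column_def adjacency_def simple_graph_def irreflp_def)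
    then show ?thesis by (simp add: A)
  qed
  then have "nonneg_on sum_zero (shift ?A 1)"
    by (simp add: nonneg_on_def shift_def A)
  then show False using neg by simp
qed

lemma max_nullity_main_angles:
  assumes E: "simple_graph E" and neg: "\<not> nonneg_on sum_zero (shift (adjacency E) 1)"
  obtains k where "max_nullity E k" "k + 1 = Max {m1' (adjacency E), m2' (adjacency E), 2}"
proof -
  note sym = symmetric_adjacency[OF E]
  obtain c where c: "c > 1" "nonneg_on sum_zero (shift (adjacency E) c)"
    "0 < dim (null_on sum_zero (shift (adjacency E) c))"
    using exists_critical_shift[OF sym neg] .
  interpret critical_shift "adjacency E" c
    using sym two_eigenvalues[OF E neg] c by unfold_locales
  show ?thesis
    using that[OF max_nullity_pos[OF c(1,2) refl c(3)] main_angles_nullity] .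
qed

text \<open>Without induced paths on three vertices, being equal or adjacent is transitive; the
  blocks are its classes.\<close>

lemma disjoint_union_if_nonneg:
  fixes E :: "'v::finite \<Rightarrow> 'v \<Rightarrow> bool"
  assumes E: "simple_graph E" and nn: "nonneg_on sum_zero (shift (adjacency E) 1)"
  obtains P where "disjoint_union_of_completes E P"
proof -
  define R where "R = {(u, v). u = v \<or> E u v}"
  have "equiv UNIV R"
  proof (rule equivI)
    show "refl_on UNIV R" by (simp add: R_def refl_on_def)
    show "sym_on UNIV R" using E by (auto simp: R_def simple_graph_def symp_def intro!: symI)
    show "trans_on UNIV R"
      using not_nonneg_if_induced_path[OF E] nn by (auto simp: R_def intro!: transI)
  qed auto
  then have R: "equiv UNIV R" .
  have "E u v \<longleftrightarrow> u \<noteq> v \<and> (\<exists>B\<in>UNIV // R. u \<in> B \<and> v \<in> B)" for u v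
  proof -
    have "(\<exists>B\<in>UNIV // R. u \<in> B \<and> v \<in> B) \<longleftrightarrow> (u, v) \<in> R"
      using R by (metis Image_singleton_iff equiv_class_self quotientI UNIV_I quotient_eq_iff)
    then show ?thesis using E by (auto simp: R_def simple_graph_def irreflp_def)
  qed
  then have "disjoint_union_of_completes E (UNIV // R)"
    using partition_on_quotient[OF R] by (simp add: disjoint_union_of_completes_def)
  then show ?thesis using that by blast
qed

lemma complete_graph_if_single_block:
  assumes P: "disjoint_union_of_completes E P" and "card P < 2"
  shows "complete_graph E"
proof -
  have "finite P" by simp
  moreover have "P \<noteq> {}"
    using P by (auto simp: disjoint_union_of_completes_def partition_on_def)
  ultimately have "card P = 1" using assms(2) by (metis One_nat_def card_0_eq less_2_cases)
  then obtain B where "P = {B}" by (auto simp: card_1_singleton_iff)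
  then show ?thesis
    using P by (auto simp: disjoint_union_of_completes_def partition_on_def complete_graph_def)
qed

lemma disjoint_union_complete: "complete_graph E \<Longrightarrow> disjoint_union_of_completes E {UNIV}"
  by (auto simp: complete_graph_def disjoint_union_of_completes_def partition_on_def disjoint_def)

lemma disjoint_union_empty:
  assumes "simple_graph E" "complete_graph (complement E)"
  shows "disjoint_union_of_completes E (range (\<lambda>v. {v}))"
  using assms
  by (auto simp: complete_graph_def complement_def disjoint_union_of_completes_def partition_on_def
      disjoint_def simple_graph_def irreflp_def)

section \<open>Quadratic forms of a disjoint union and of its complement\<close>

definition block_sum :: "real ^ 'v::finite \<Rightarrow> 'v set \<Rightarrow> real" where
  "block_sum x B = (\<Sum>v\<in>B. x $ v)"

definition block_vec :: "'v set \<Rightarrow> real ^ 'v::finite" where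
  "block_vec B = (\<chi> v. if v \<in> B then 1 else 0)"

lemma inner_block_vec: "x \<bullet> block_vec B = block_sum x B"
  by (simp add: inner_vec_def block_vec_def block_sum_def if_distrib sum.If_cases cong: if_cong)

context
  fixes E :: "'v::finite \<Rightarrow> 'v \<Rightarrow> bool" and P :: "'v set set"
  assumes P: "disjoint_union_of_completes E P"
begin

lemma blocks: "partition_on UNIV P" "E u v \<longleftrightarrow> u \<noteq> v \<and> (\<exists>B\<in>P. u \<in> B \<and> v \<in> B)"
  using P by (auto simp: disjoint_union_of_completes_def)

lemma block_unique: "B \<in> P \<Longrightarrow> B' \<in> P \<Longrightarrow> u \<in> B \<Longrightarrow> u \<in> B' \<Longrightarrow> B = B'"
  using blocks(1) by (auto simp: partition_on_def disjoint_def)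

lemma block_nonempty: "B \<in> P \<Longrightarrow> 1 \<le> card B"
  using blocks(1) by (auto simp: partition_on_def Suc_le_eq card_gt_0_iff)

lemma obtain_block: obtains B where "B \<in> P" "u \<in> B"
  using partition_onD1[OF blocks(1)] by blast

lemma sum_blocks: "(\<Sum>v\<in>UNIV. f v) = (\<Sum>B\<in>P. \<Sum>v\<in>B. f v)"
  for f :: "'v \<Rightarrow> real"
proof -
  have "UNIV = \<Union>P" using blocks(1) by (simp add: partition_on_def)
  then show ?thesis
    using block_unique by (subst \<open>UNIV = \<Union>P\<close>, subst sum.Union_disjoint) auto
qed

text \<open>A + I is block diagonal with all-ones blocks.\<close>

lemma shift_component:
  assumes B: "B \<in> P" "u \<in> B"
  shows "shift (adjacency E) 1 x $ u = block_sum x B"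
proof -
  have "shift (adjacency E) 1 x $ u = (\<Sum>v\<in>UNIV. (if E u v then x $ v else 0)) + x $ u"
    by (simp add: shift_def matrix_vector_mult_def adjacency_def if_distrib[of "\<lambda>a. a * _"] cong: if_cong)
  also have "(\<Sum>v\<in>UNIV. (if E u v then x $ v else 0)) = (\<Sum>v\<in>B - {u}. x $ v)"
    unfolding sum.inter_filter[OF finite, symmetric]
    by (rule sum.cong) (use B block_unique blocks(2) in auto)
  also have "\<dots> + x $ u = block_sum x B"
    using B by (simp add: block_sum_def sum.remove[of B u])
  finally show ?thesis .
qed

lemma block_form: "x \<bullet> shift (adjacency E) 1 x = (\<Sum>B\<in>P. (block_sum x B)\<^sup>2)"
proof -
  have "x \<bullet> shift (adjacency E) 1 x = (\<Sum>B\<in>P. \<Sum>v\<in>B. x $ v * shift (adjacency E) 1 x $ v)"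
    by (simp add: inner_vec_def sum_blocks)
  also have "\<dots> = (\<Sum>B\<in>P. \<Sum>v\<in>B. x $ v * block_sum x B)"
    by (intro sum.cong refl) (simp add: shift_component)
  also have "\<dots> = (\<Sum>B\<in>P. (block_sum x B)\<^sup>2)"
    by (simp add: sum_distrib_right[symmetric] block_sum_def power2_eq_square)
  finally show ?thesis .
qed

lemma nonneg_disjoint_union: "nonneg_on sum_zero (shift (adjacency E) 1)"
  by (simp add: nonneg_on_def block_form sum_nonneg)

lemma block_sum_sq_le:
  "(block_sum x B)\<^sup>2 \<le> real (card B) * (\<Sum>v\<in>B. (x $ v)\<^sup>2)"
  using Cauchy_Schwarz_ineq_sum[of "\<lambda>_. 1" "\<lambda>v. x $ v" B] by (simp add: block_sum_def)


lemma complement_form: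
  assumes E: "simple_graph E" and x: "x \<in> sum_zero"
  shows "x \<bullet> shift (adjacency (complement E)) c x =
    (\<Sum>B\<in>P. c * (\<Sum>v\<in>B. (x $ v)\<^sup>2) - (block_sum x B)\<^sup>2)"
proof -
  have "x \<bullet> x = (\<Sum>B\<in>P. \<Sum>v\<in>B. (x $ v)\<^sup>2)"
    by (simp add: inner_vec_def sum_blocks power2_eq_square)
  then show ?thesis
    using block_form[of x]
    by (simp add: inner_shift sum_zero_inner_adjacency_complement[OF E x] sum_subtractf sum_distrib_left)
qed

text \<open>Bounds \<open>c\<close> below by the harmonic mean of two block sizes, using a vector
  constant on each block, with values balanced to sum to zero.\<close>

lemma complement_two_blocks:
  assumes E: "simple_graph E" and nn: "nonneg_on sum_zero (shift (adjacency (complement E)) c)"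
    and B: "B \<in> P" "B' \<in> P" "B \<noteq> B'"
  shows "2 * (real (card B) * real (card B')) \<le> c * (real (card B) + real (card B'))"
proof -
  let ?a = "real (card B)" and ?b = "real (card B')"
  have ab: "1 \<le> ?a" "1 \<le> ?b" using block_nonempty B by simp_all
  have dj: "B \<inter> B' = {}" using block_unique B by blast
  define x :: "real ^ 'v" where "x = (\<chi> v. if v \<in> B then ?b else if v \<in> B' then - ?a else 0)"
  have xB: "x $ v = ?b" if "v \<in> B" for v using that by (simp add: x_def)
  have xB': "x $ v = - ?a" if "v \<in> B'" for v using that dj by (auto simp: x_def)
  have x0: "x $ v = 0" if "C \<in> P - {B, B'}" "v \<in> C" for C v
    using that block_unique B by (auto simp: x_def)
  have split: "(\<Sum>C\<in>P. f C) = f B + f B'" if "\<And>C. C \<in> P - {B, B'} \<Longrightarrow> f C = 0" for f :: "'v set \<Rightarrow> real"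
  proof -
    have "(\<Sum>C\<in>P. f C) = (\<Sum>C\<in>{B, B'}. f C)"
      using that B by (intro sum.mono_neutral_right) auto
    then show ?thesis using B by simp
  qed
  have "x \<bullet> ones = (\<Sum>v\<in>B. x $ v) + (\<Sum>v\<in>B'. x $ v)"
    unfolding inner_ones sum_blocks by (rule split) (simp add: x0)
  then have xz: "x \<in> sum_zero" by (simp add: sum_zero_def xB xB')
  then have "0 \<le> x \<bullet> shift (adjacency (complement E)) c x"
    using nn by (simp add: nonneg_on_def)
  also have "\<dots> = (c * (\<Sum>v\<in>B. (x $ v)\<^sup>2) - (block_sum x B)\<^sup>2) + (c * (\<Sum>v\<in>B'. (x $ v)\<^sup>2) - (block_sum x B')\<^sup>2)"
    unfolding complement_form[OF E xz] by (rule split) (simp add: x0 block_sum_def)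
  also have "\<dots> = (?a * ?b) * (c * (?a + ?b) - 2 * (?a * ?b))"
    by (simp add: block_sum_def xB xB' power2_eq_square algebra_simps)
  finally have "0 \<le> (?a * ?b) * (c * (?a + ?b) - 2 * (?a * ?b))" .
  moreover have "0 < ?a * ?b" using ab by simp
  ultimately show ?thesis
    using zero_le_mult_iff[of "?a * ?b" "c * (?a + ?b) - 2 * (?a * ?b)"] by linarith
qed

section \<open>The blocks of largest size\<close>

definition largest_blocks :: "'v set set" where
  "largest_blocks = {B \<in> P. card B = Max (card ` P)}"

lemma card_block_le: "B \<in> P \<Longrightarrow> card B \<le> Max (card ` P)"
  by simp

lemma largest_blocks_nonempty: "largest_blocks \<noteq> {}"
proof -
  obtain B where "B \<in> P" using obtain_block by blast
  then have "Max (card ` P) \<in> card ` P" by (intro Max_in) auto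
  then show ?thesis by (auto simp: largest_blocks_def)
qed

lemma block_vec_eigenspace:
  assumes B: "B \<in> P"
  shows "block_vec B \<in> eigenspace (adjacency E) (real (card B) - 1)"
proof -
  have "shift (adjacency E) 1 (block_vec B) $ v = (real (card B) *\<^sub>R block_vec B) $ v" for v
  proof -
    obtain C where C: "C \<in> P" "v \<in> C" using obtain_block .
    have "block_sum (block_vec B) C = real (card (C \<inter> B))"
      by (simp add: block_sum_def block_vec_def sum.If_cases)
    also have "\<dots> = (if C = B then real (card B) else 0)"
      using B C block_unique[of C B] by (auto simp: card_eq_0_iff)
    finally show ?thesis
      using shift_component[OF C, of "block_vec B"] B C block_unique[of C B v] by (auto simp: block_vec_def)
  qed
  then have "shift (adjacency E) 1 (block_vec B) = real (card B) *\<^sub>R block_vec B"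
    by (simp add: vec_eq_iff)
  then show ?thesis by (simp add: eigenspace_def shift_def algebra_simps)
qed

text \<open>An eigenvector of A + I for the largest block size is constant on each block and
  vanishes on smaller blocks, so the indicators of the largest blocks form an orthogonal
  basis.\<close>

lemma dim_largest_eigenspace:
  "dim (eigenspace (adjacency E) (real (Max (card ` P)) - 1)) = card largest_blocks"
proof -
  let ?N = "Max (card ` P)"
  have eig: "x \<in> eigenspace (adjacency E) (real ?N - 1) \<longleftrightarrow> shift (adjacency E) 1 x = real ?N *\<^sub>R x" for x
    by (simp add: eigenspace_def shift_def algebra_simps)
  have sub: "eigenspace (adjacency E) (real ?N - 1) \<subseteq> span (block_vec ` largest_blocks)"
  proof
    fix x assume "x \<in> eigenspace (adjacency E) (real ?N - 1)"
    then have x: "real ?N * x $ v = block_sum x B" if "B \<in> P" "v \<in> B" for v B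
      using that shift_component[OF that, of x] by (simp add: eig)
    obtain B0 where "B0 \<in> P" using obtain_block by blast
    then have N: "1 \<le> ?N" using block_nonempty[of B0] card_block_le[of B0] by linarith
    \<comment> \<open>Summing the eigenvalue equation over the block multiplies the block sum by
      \<open>?N\<close> on one side and by the smaller \<open>card B\<close> on the other.\<close>
    have small: "x $ v = 0" if B: "B \<in> P" "v \<in> B" "B \<notin> largest_blocks" for v B
    proof -
      have "real ?N * block_sum x B = (\<Sum>v\<in>B. real ?N * x $ v)"
        by (simp add: block_sum_def sum_distrib_left)
      also have "\<dots> = real (card B) * block_sum x B" using x[OF B(1)] by simp
      finally have "block_sum x B = 0" using B by (auto simp: largest_blocks_def)
      then show ?thesis using x[OF B(1,2)] N by simp
    qed
    have "x = (\<Sum>B\<in>largest_blocks. (block_sum x B / real ?N) *\<^sub>R block_vec B)"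
    proof (rule vec_eq_iff[THEN iffD2], rule allI)
      fix v
      obtain B where B: "B \<in> P" "v \<in> B" using obtain_block .
      have "(\<Sum>C\<in>largest_blocks. (block_sum x C / real ?N) *\<^sub>R block_vec C) $ v =
          (\<Sum>C\<in>largest_blocks. if C = B then x $ v else 0)"
        unfolding sum_component
      proof (rule sum.cong[OF refl])
        fix C assume "C \<in> largest_blocks"
        then have "C \<in> P" by (simp add: largest_blocks_def)
        then have "v \<in> C \<longleftrightarrow> C = B" using B block_unique by blast
        moreover have "block_sum x B / real ?N = x $ v" unfolding x[OF B, symmetric] using N by simp
        ultimately show "((block_sum x C / real ?N) *\<^sub>R block_vec C) $ v = (if C = B then x $ v else 0)"
          by (simp add: block_vec_def)
      qed
      then show "x $ v = (\<Sum>C\<in>largest_blocks. (block_sum x C / real ?N) *\<^sub>R block_vec C) $ v"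
        using small[OF B] by (cases "B \<in> largest_blocks") simp_all
    qed
    also have "\<dots> \<in> span (block_vec ` largest_blocks)"
      by (intro span_sum span_scale span_base) auto
    finally show "x \<in> span (block_vec ` largest_blocks)" .
  qed
  have "block_vec ` largest_blocks \<subseteq> eigenspace (adjacency E) (real ?N - 1)"
    using block_vec_eigenspace by (force simp: largest_blocks_def)
  then have "eigenspace (adjacency E) (real ?N - 1) = span (block_vec ` largest_blocks)"
    using sub span_minimal subspace_eigenspace by blast
  moreover have "independent (block_vec ` largest_blocks)"
  proof (rule pairwise_orthogonal_independent)
    have "block_vec B \<bullet> block_vec C = 0" if "B \<in> P" "C \<in> P" "B \<noteq> C" for B C
    proof -
      have "v \<notin> B" if "v \<in> C" for v using that \<open>B \<in> P\<close> \<open>C \<in> P\<close> \<open>B \<noteq> C\<close> block_unique by blast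
      then show ?thesis unfolding inner_block_vec by (simp add: block_sum_def block_vec_def)
    qed
    then show "pairwise orthogonal (block_vec ` largest_blocks)"
      unfolding pairwise_def orthogonal_def largest_blocks_def by blast
    have "block_vec B \<noteq> 0" if "B \<in> P" for B
    proof -
      obtain v where "v \<in> B" using partition_onD3[OF blocks(1)] \<open>B \<in> P\<close> by (metis all_not_in_conv)
      then show ?thesis by (auto simp: block_vec_def vec_eq_iff)
    qed
    then show "0 \<notin> block_vec ` largest_blocks" by (force simp: largest_blocks_def)
  qed
  moreover have "inj_on block_vec largest_blocks"
    by (rule inj_onI) (simp add: block_vec_def vec_eq_iff set_eq_iff, metis zero_neq_one)
  ultimately show ?thesis
    by (simp add: dim_eq_card_independent card_image)
qed

lemma complement_nonneg_largest:
  assumes E: "simple_graph E"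
  shows "nonneg_on sum_zero (shift (adjacency (complement E)) (real (Max (card ` P))))"
    and "null_on sum_zero (shift (adjacency (complement E)) (real (Max (card ` P)))) =
      eigenspace (adjacency E) (real (Max (card ` P)) - 1) \<inter> sum_zero"
proof -
  let ?N = "real (Max (card ` P))"
  \<comment> \<open>This is \<open>?N\<close> I - (A + I), which has the same form on
    \<open>sum_zero\<close> but is nonnegative on the whole space, so null vectors are kernel
    vectors.\<close>
  define T where "T x = - shift (adjacency E) (1 - ?N) x" for x
  have "self_adjoint (shift (adjacency E) (1 - ?N))"
    by (rule self_adjoint_shift[OF symmetric_adjacency[OF E]])
  then have T: "self_adjoint T"
    unfolding self_adjoint_def T_def by (simp add: linear_compose_neg)
  have form: "x \<bullet> T x = (\<Sum>B\<in>P. ?N * (\<Sum>v\<in>B. (x $ v)\<^sup>2) - (block_sum x B)\<^sup>2)" for x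
  proof -
    have "x \<bullet> x = (\<Sum>B\<in>P. \<Sum>v\<in>B. (x $ v)\<^sup>2)"
      by (simp add: inner_vec_def sum_blocks power2_eq_square)
    then show ?thesis
      using block_form[of x] by (simp add: T_def inner_shift sum_subtractf sum_distrib_left algebra_simps)
  qed
  have nn: "nonneg_on UNIV T"
    unfolding nonneg_on_def form
  proof (intro ballI sum_nonneg)
    fix x B assume "B \<in> P"
    then have "real (card B) * (\<Sum>v\<in>B. (x $ v)\<^sup>2) \<le> ?N * (\<Sum>v\<in>B. (x $ v)\<^sup>2)"
      using card_block_le by (intro mult_right_mono sum_nonneg) auto
    then show "0 \<le> ?N * (\<Sum>v\<in>B. (x $ v)\<^sup>2) - (block_sum x B)\<^sup>2"
      using block_sum_sq_le[of x B] by linarith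
  qed
  have eq: "x \<bullet> shift (adjacency (complement E)) ?N x = x \<bullet> T x" if "x \<in> sum_zero" for x
    using complement_form[OF E that] form by simp
  show "nonneg_on sum_zero (shift (adjacency (complement E)) ?N)"
    using nn by (simp add: nonneg_on_def eq)
  have "x \<in> null_on UNIV T \<longleftrightarrow> x \<in> eigenspace (adjacency E) (?N - 1)" for x
  proof -
    have "x \<in> null_on UNIV T \<longleftrightarrow> (\<forall>y. y \<bullet> T x = 0)"
      using null_on_iff[OF T subspace_UNIV nn] by simp
    also have "\<dots> \<longleftrightarrow> T x = 0" by (metis inner_eq_zero_iff inner_zero_right)
    also have "\<dots> \<longleftrightarrow> x \<in> eigenspace (adjacency E) (?N - 1)"
      by (auto simp: T_def shift_def eigenspace_def algebra_simps)
    finally show ?thesis .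
  qed
  then show "null_on sum_zero (shift (adjacency (complement E)) ?N) =
      eigenspace (adjacency E) (?N - 1) \<inter> sum_zero"
    using eq by (auto simp: null_on_def)
qed

text \<open>With r \<ge> 2 largest blocks the critical shift is their size and the hyperplane cuts
  the eigenspace down to r - 1. With one largest block the nullity is 1.\<close>

lemma max_nullity_complement:
  assumes E: "simple_graph E" and card_P: "2 \<le> card P" and ne: "\<not> complete_graph (complement E)"
  shows "max_nullity (complement E) (max (num_largest_blocks P) 2 - 1)"
proof -
  let ?A' = "adjacency (complement E)" and ?N = "Max (card ` P)"
  have r: "num_largest_blocks P = card largest_blocks"
    by (simp add: num_largest_blocks_def largest_blocks_def)
  obtain B where B: "B \<in> P" "card B = ?N" using largest_blocks_nonempty by (auto simp: largest_blocks_def)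
  \<comment> \<open>The graph has an edge, so the largest size exceeds 1 and is an admissible
    shift.\<close>
  have N2: "2 \<le> ?N"
  proof -
    obtain u v where "E u v" "u \<noteq> v"
      using ne E by (auto simp: complete_graph_def complement_def simple_graph_def irreflp_def)
    then obtain C where C: "C \<in> P" "u \<in> C" "v \<in> C" using blocks(2) by blast
    then have "card {u, v} \<le> card C" by (intro card_mono) auto
    then show ?thesis using card_block_le[OF C(1)] \<open>u \<noteq> v\<close> by simp
  qed
  show ?thesis
  proof (cases "2 \<le> card largest_blocks")
    case True
    have "block_vec B \<in> eigenspace (adjacency E) (real ?N - 1)"
      using block_vec_eigenspace B by metis
    moreover have "block_vec B \<bullet> ones \<noteq> 0"
      using B N2 by (simp add: inner_ones block_vec_def sum.If_cases)
    ultimately have "card largest_blocks = dim (eigenspace (adjacency E) (real ?N - 1) \<inter> sum_zero) + 1"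
      unfolding sum_zero_def dim_largest_eigenspace[symmetric]
      by (rule dim_Int_hyperplane[OF subspace_eigenspace])
    then have "card largest_blocks = dim (null_on sum_zero (shift ?A' (real ?N))) + 1"
      by (simp only: complement_nonneg_largest(2)[OF E])
    then show ?thesis
      using True N2 unfolding r by (intro max_nullity_pos[OF _ complement_nonneg_largest(1)[OF E]]) auto
  next
    case False
    then have "card largest_blocks = 1"
      using largest_blocks_nonempty by (metis One_nat_def card_0_eq finite less_2_cases not_le)
    then have smaller: "card C < ?N" if "C \<in> P" "C \<noteq> B" for C
      using that B card_block_le[of C] by (auto simp: card_1_singleton_iff largest_blocks_def le_less)
    have "\<not> P \<subseteq> {B}" using card_P card_mono[of "{B}" P] by auto
    then obtain C0 where C0: "C0 \<in> P" "C0 \<noteq> B" by blast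
    have "\<not> nonneg_on sum_zero (shift ?A' 1)"
    proof
      assume "nonneg_on sum_zero (shift ?A' 1)"
      from complement_two_blocks[OF E this B(1) C0(1)] C0(2)
      have "2 * (?N * card C0) \<le> ?N + card C0"
        by (simp add: B(2) flip: of_nat_mult of_nat_add)
      moreover have "?N * 1 \<le> ?N * card C0" "2 * card C0 \<le> ?N * card C0"
        using block_nonempty[OF C0(1)] N2 by (intro mult_le_mono; simp)+
      ultimately show False using block_nonempty[OF C0(1)] by linarith
    qed
    then obtain c where c: "c > 1" "nonneg_on sum_zero (shift ?A' c)"
      "0 < dim (null_on sum_zero (shift ?A' c))"
      using exists_critical_shift symmetric_adjacency simple_graph_complement[OF E] by metis
    \<comment> \<open>The harmonic mean of two different sizes exceeds the smaller one.\<close>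
    have cC: "real (card C) < c" if C: "C \<in> P" "C \<noteq> B" for C
    proof -
      have "2 * (real ?N * real (card C)) \<le> c * (real ?N + real (card C))"
        using complement_two_blocks[OF E c(2) B(1) C(1)] C(2) B(2) by simp
      moreover have "real (card C) * real (card C) < real ?N * real (card C)"
        using smaller[OF C] block_nonempty[OF C(1)] by simp
      ultimately have "real (card C) * (real ?N + real (card C)) < c * (real ?N + real (card C))"
        by (simp add: algebra_simps)
      then show ?thesis using N2 by (simp add: mult_less_cancel_right)
    qed
    \<comment> \<open>Once the block sum over \<open>B\<close> is 0, the form splits into blockwise
      terms that are positive definite: on \<open>B\<close> trivially, elsewhere by Cauchy-Schwarz
      and the bound on sizes.\<close>
    have "null_on sum_zero (shift ?A' c) \<inter> {x. x \<bullet> block_vec B = 0} \<subseteq> {0}"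
    proof
      fix x assume "x \<in> null_on sum_zero (shift ?A' c) \<inter> {x. x \<bullet> block_vec B = 0}"
      then have x: "x \<in> sum_zero" "x \<bullet> shift ?A' c x = 0" "block_sum x B = 0"
        by (auto simp: null_on_def inner_block_vec)
      define q where "q C = (\<Sum>v\<in>C. (x $ v)\<^sup>2)" for C
      have q0: "0 \<le> q C" for C by (simp add: q_def sum_nonneg)
      have summand: "0 \<le> c * q C - (block_sum x C)\<^sup>2 \<and> (c * q C - (block_sum x C)\<^sup>2 = 0 \<longrightarrow> q C = 0)"
        if C: "C \<in> P" for C
      proof (cases "C = B")
        case True
        then show ?thesis using x(3) c(1) q0[of B] by simp
      next
        case False
        have "(block_sum x C)\<^sup>2 \<le> real (card C) * q C"
          using block_sum_sq_le by (simp add: q_def)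
        moreover have "real (card C) * q C \<le> c * q C"
          using cC[OF C False] q0 by (simp add: mult_right_mono)
        moreover have "real (card C) * q C < c * q C" if "q C \<noteq> 0"
          using cC[OF C False] q0[of C] that by simp
        ultimately show ?thesis by force
      qed
      have "(\<Sum>C\<in>P. c * q C - (block_sum x C)\<^sup>2) = 0"
        using complement_form[OF E x(1), of c] x(2) by (simp add: q_def)
      then have "\<forall>C\<in>P. c * q C - (block_sum x C)\<^sup>2 = 0"
        using summand by (subst (asm) sum_nonneg_eq_0_iff) auto
      then have "\<forall>C\<in>P. q C = 0" using summand by blast
      then have "x $ v = 0" if "C \<in> P" "v \<in> C" for C v
        using that by (simp add: q_def sum_nonneg_eq_0_iff)
      then have "x = 0" by (metis obtain_block vec_eq_iff zero_index)
      then show "x \<in> {0}" by simp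
    qed
    then have "dim (null_on sum_zero (shift ?A' c) \<inter> {x. x \<bullet> block_vec B = 0}) = 0" by (simp only: dim_eq_0)
    then have "dim (null_on sum_zero (shift ?A' c)) \<le> 1"
      using dim_Int_hyperplane_ge[of "null_on sum_zero (shift ?A' c)" "block_vec B"]
        subspace_null_on[OF self_adjoint_shift subspace_sum_zero c(2)]
        symmetric_adjacency[OF simple_graph_complement[OF E]] by linarith
    then show ?thesis
      using False c(3) unfolding r by (intro max_nullity_pos[OF c(1,2)]) auto
  qed
qed

end

section \<open>The representation number\<close>

theorem theorem2p6:
  fixes E :: "'v::finite \<Rightarrow> 'v \<Rightarrow> bool" and n :: nat
  assumes "simple_graph E" and "n = CARD('v)"
  shows
    "(complete_graph E \<or> complete_graph (complement E) \<longrightarrow> int (Rep E) = int n - 1)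
     \<and>
     (\<not> (complete_graph E \<or> complete_graph (complement E)) \<longrightarrow>
       (\<forall>P r. card P \<ge> 2 \<and>
              (disjoint_union_of_completes E P \<or> disjoint_union_of_completes (complement E) P) \<and>
              r = num_largest_blocks P \<longrightarrow>
              int (Rep E) = int n - int (max r 2)))
     \<and>
     (\<not> (complete_graph E \<or> complete_graph (complement E)) \<and>
      \<not> (\<exists>P. card P \<ge> 2 \<and>
             (disjoint_union_of_completes E P \<or> disjoint_union_of_completes (complement E) P)) \<longrightarrow>
       int (Rep E) = int n -
         int (Max {m1' (adjacency E), m2' (adjacency E),
                   m1' (adjacency (complement E)), m2' (adjacency (complement E)), 2}))"
proof (intro conjI impI allI)
  note E = assms(1)
  note E' = simple_graph_complement[OF E] and EE = complement_complement[OF E]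
  \<comment> \<open>A disjoint union of complete graphs contributes 0, so only its complement can
    lower the dimension.\<close>
  have block_nullity: "max_nullity F 0" if "disjoint_union_of_completes F P" for F :: "'v \<Rightarrow> 'v \<Rightarrow> bool" and P
    by (rule max_nullity_0[OF nonneg_disjoint_union[OF that]])
  show "int (Rep E) = int n - 1" if "complete_graph E \<or> complete_graph (complement E)"
  proof -
    have "max_nullity E 0 \<and> max_nullity (complement E) 0"
      using that disjoint_union_complete disjoint_union_empty[OF E] disjoint_union_empty[OF E'] EE
        block_nullity by metis
    then show ?thesis using Rep_eq[OF E] assms(2) by force
  qed
  show "int (Rep E) = int n - int (max r 2)"
    if nc: "\<not> (complete_graph E \<or> complete_graph (complement E))"
      and *: "card P \<ge> 2 \<and> (disjoint_union_of_completes E P \<or> disjoint_union_of_completes (complement E) P) \<and>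
        r = num_largest_blocks P" for P r
  proof -
    let ?k = "max r 2 - 1"
    have "max_nullity E 0 \<and> max_nullity (complement E) ?k \<or> max_nullity E ?k \<and> max_nullity (complement E) 0"
      using * nc max_nullity_complement[OF _ E, of P] max_nullity_complement[OF _ E', of P] EE
        block_nullity by auto
    then have "int (Rep E) = int CARD('v) - 1 - int ?k"
      using Rep_eq[OF E, of 0 ?k] Rep_eq[OF E, of ?k 0] by auto
    then show ?thesis using assms(2) by simp
  qed
  show "int (Rep E) = int n -
         int (Max {m1' (adjacency E), m2' (adjacency E),
                   m1' (adjacency (complement E)), m2' (adjacency (complement E)), 2})"
    if *: "\<not> (complete_graph E \<or> complete_graph (complement E)) \<and>
      \<not> (\<exists>P. card P \<ge> 2 \<and>
             (disjoint_union_of_completes E P \<or> disjoint_union_of_completes (complement E) P))"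
  proof -
    \<comment> \<open>Otherwise \<open>F\<close> would be a disjoint union: two or more blocks are
      excluded directly, and a single block makes \<open>F\<close> complete.\<close>
    have neg: "\<not> nonneg_on sum_zero (shift (adjacency F) 1)" if F: "F = E \<or> F = complement E" for F
    proof
      assume nn: "nonneg_on sum_zero (shift (adjacency F) 1)"
      have "simple_graph F" using F E E' by blast
      then obtain P where P: "disjoint_union_of_completes F P"
        using disjoint_union_if_nonneg nn by blast
      then show False
        using complete_graph_if_single_block[OF P] * F by (metis not_le)
    qed
    obtain k where k: "max_nullity E k" "k + 1 = Max {m1' (adjacency E), m2' (adjacency E), 2}"
      using max_nullity_main_angles[OF E neg] by blast
    obtain k' where k': "max_nullity (complement E) k'"
      "k' + 1 = Max {m1' (adjacency (complement E)), m2' (adjacency (complement E)), 2}"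
      using max_nullity_main_angles[OF E' neg] by blast
    have "Max {m1' (adjacency E), m2' (adjacency E),
        m1' (adjacency (complement E)), m2' (adjacency (complement E)), 2} = max (k + 1) (k' + 1)"
      unfolding k(2) k'(2) by (simp add: ac_simps)
    then show ?thesis
      using Rep_eq[OF E k(1) k'(1)] assms(2) by simp
  qed
qed

end
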